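(* Let $\mathfrak g$ be a complex semisimple Lie algebra and consider its adjoint representation on $V = \mathfrak g$. Then the Lie algebra $\mathbb C[V]\otimes\mathfrak g$ of polynomial vector fields $\sum_k f_k \vec\xi_k$ ($f_k$ polynomial on $V$, $\xi_k\in\mathfrak g$) is generated, as a Lie algebra, by its $\mathfrak g$-overshears, i.e. by the vector fields $f\vec\xi$ with $f\in\mathbb C[V]$, $\xi\in\mathfrak g$ and $\vec\xi^{\,2} f = 0$.
   Context: For $\xi \in \mathfrak g$, $\vec\xi$ is the linear holomorphic vector field on $V = \mathfrak g$ given by $\vec\xi f(p) = \frac{d}{dt}|_{t=0} f(e^{t\,\mathrm{ad}\xi}p)$. Such vector fields are complete, and by a known result $f\vec\xi$ is then complete whenever $\vec\xi^{\,2}f=0$. *)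

theory Defs
  imports "HOL-Analysis.Analysis"
begin

text \<open>The Lie algebra g is modelled on V = complex^'n (any finite dimension) with a
  bracket br. Vector fields on V are maps V \<Rightarrow> V.\<close>

definition lie_algebra :: "(complex^'n \<Rightarrow> complex^'n \<Rightarrow> complex^'n) \<Rightarrow> bool" where
  "lie_algebra br \<longleftrightarrow>
     (\<forall>x y z. br (x + y) z = br x z + br y z) \<and>
     (\<forall>x y z. br x (y + z) = br x y + br x z) \<and>
     (\<forall>(c::complex) x y. br (c *s x) y = c *s br x y) \<and>
     (\<forall>(c::complex) x y. br x (c *s y) = c *s br x y) \<and>
     (\<forall>x. br x x = 0) \<and>
     (\<forall>x y z. br x (br y z) + br y (br z x) + br z (br x y) = 0)"

definition csubspace :: "(complex^'n) set \<Rightarrow> bool" where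
  "csubspace S \<longleftrightarrow> 0 \<in> S \<and> (\<forall>x\<in>S. \<forall>y\<in>S. x + y \<in> S) \<and> (\<forall>(c::complex). \<forall>x\<in>S. c *s x \<in> S)"

definition cspan :: "(complex^'n) set \<Rightarrow> (complex^'n) set" where
  "cspan S = \<Inter>{T. csubspace T \<and> S \<subseteq> T}"

definition lie_ideal :: "(complex^'n \<Rightarrow> complex^'n \<Rightarrow> complex^'n) \<Rightarrow> (complex^'n) set \<Rightarrow> bool" where
  "lie_ideal br I \<longleftrightarrow> csubspace I \<and> (\<forall>x\<in>I. \<forall>y. br y x \<in> I)"

fun derived :: "(complex^'n \<Rightarrow> complex^'n \<Rightarrow> complex^'n) \<Rightarrow> (complex^'n) set \<Rightarrow> nat \<Rightarrow> (complex^'n) set" where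
  "derived br I 0 = I"
| "derived br I (Suc k) = cspan {br x y | x y. x \<in> derived br I k \<and> y \<in> derived br I k}"

definition solvable_sub :: "(complex^'n \<Rightarrow> complex^'n \<Rightarrow> complex^'n) \<Rightarrow> (complex^'n) set \<Rightarrow> bool" where
  "solvable_sub br I \<longleftrightarrow> (\<exists>k. derived br I k = {0})"

definition semisimple :: "(complex^'n \<Rightarrow> complex^'n \<Rightarrow> complex^'n) \<Rightarrow> bool" where
  "semisimple br \<longleftrightarrow> lie_algebra br \<and> (\<forall>I. lie_ideal br I \<and> solvable_sub br I \<longrightarrow> I = {0})"

inductive_set cpoly :: "(complex^'n \<Rightarrow> complex) set" where
  const: "(\<lambda>p. c) \<in> cpoly"
| coord: "(\<lambda>p. p $ i) \<in> cpoly"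
| add: "f \<in> cpoly \<Longrightarrow> g \<in> cpoly \<Longrightarrow> (\<lambda>p. f p + g p) \<in> cpoly"
| mult: "f \<in> cpoly \<Longrightarrow> g \<in> cpoly \<Longrightarrow> (\<lambda>p. f p * g p) \<in> cpoly"

definition vf_apply :: "(complex^'n \<Rightarrow> complex^'n) \<Rightarrow> (complex^'n \<Rightarrow> 'b::real_normed_vector) \<Rightarrow> complex^'n \<Rightarrow> 'b" where
  "vf_apply X h p = frechet_derivative h (at p) (X p)"

text \<open>The linear vector field \<xi>-arrow: p \<mapsto> [\<xi>, p] = d/dt e^{t ad \<xi>} p at t = 0.\<close>
definition lin_vf :: "(complex^'n \<Rightarrow> complex^'n \<Rightarrow> complex^'n) \<Rightarrow> complex^'n \<Rightarrow> (complex^'n \<Rightarrow> complex^'n)" where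
  "lin_vf br \<xi> = (\<lambda>p. br \<xi> p)"

text \<open>Lie bracket of vector fields, [X,Y] h = X (Y h) - Y (X h).\<close>
definition vf_bracket :: "(complex^'n \<Rightarrow> complex^'n) \<Rightarrow> (complex^'n \<Rightarrow> complex^'n) \<Rightarrow> (complex^'n \<Rightarrow> complex^'n)" where
  "vf_bracket X Y = (\<lambda>p. vf_apply X Y p - vf_apply Y X p)"

definition poly_fields :: "(complex^'n \<Rightarrow> complex^'n \<Rightarrow> complex^'n) \<Rightarrow> (complex^'n \<Rightarrow> complex^'n) set" where
  "poly_fields br = {X. \<exists>fs :: ((complex^'n \<Rightarrow> complex) \<times> (complex^'n)) list.
       (\<forall>(f, \<xi>) \<in> set fs. f \<in> cpoly) \<and>
       X = (\<lambda>p. sum_list (map (\<lambda>(f, \<xi>). f p *s lin_vf br \<xi> p) fs))}"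

definition overshears :: "(complex^'n \<Rightarrow> complex^'n \<Rightarrow> complex^'n) \<Rightarrow> (complex^'n \<Rightarrow> complex^'n) set" where
  "overshears br = {(\<lambda>p. f p *s lin_vf br \<xi> p) | f \<xi>.
       f \<in> cpoly \<and> vf_apply (lin_vf br \<xi>) (vf_apply (lin_vf br \<xi>) f) = (\<lambda>p. 0)}"

inductive_set lie_generated :: "(complex^'n \<Rightarrow> complex^'n) set \<Rightarrow> (complex^'n \<Rightarrow> complex^'n) set"
  for S where
  base: "X \<in> S \<Longrightarrow> X \<in> lie_generated S"
| zero: "(\<lambda>p. 0) \<in> lie_generated S"
| add: "X \<in> lie_generated S \<Longrightarrow> Y \<in> lie_generated S \<Longrightarrow> (\<lambda>p. X p + Y p) \<in> lie_generated S"
| smult: "X \<in> lie_generated S \<Longrightarrow> (\<lambda>p. (c::complex) *s X p) \<in> lie_generated S"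
| bracket: "X \<in> lie_generated S \<Longrightarrow> Y \<in> lie_generated S \<Longrightarrow> vf_bracket X Y \<in> lie_generated S"

end

theory Submission
  imports Defs "HOL-Computational_Algebra.Fundamental_Theorem_Algebra"
begin

text \<open>Write \<open>x\<^sup>k \<otimes> \<xi>\<close> for the vector field with polynomial \<open>p \<mapsto> \<kappa>(x, p)\<^sup>k\<close> and direction \<open>\<xi>\<close>, where
  \<open>\<kappa>\<close> is the Killing form. It is nondegenerate by Cartan's criterion, so these fields span all
  polynomial fields by polarization. Invariance of \<open>\<kappa>\<close> makes every \<open>x\<^sup>k \<otimes> x\<close> an overshear, and also
  \<open>d \<otimes> b\<close> whenever \<open>b\<close> is an eigenvector of \<open>ad d\<close>. The latter gives \<open>d \<otimes> \<xi>\<close> for all ad-diagonalizable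
  \<open>d\<close> and all \<open>\<xi>\<close>. The \<open>x\<close> with \<open>x \<otimes> \<xi>\<close> generated for all \<open>\<xi>\<close> form an ideal, whose orthogonal
  complement consists of ad-nilpotent elements and hence vanishes. So degree one is generated, and
  from there brackets with the \<open>x\<^sup>k \<otimes> x\<close> and \<open>[\<gg>, \<gg>] = \<gg>\<close> give all higher degrees.\<close>

section \<open>Trace and generalized eigenspaces\<close>

text \<open>The obstacle is to obtain enough ad-diagonalizable elements together with a test for
  ad-nilpotency. Both come from one operator: for given \<open>y\<close>, let \<open>S\<close>
  multiply the generalized eigenspace of \<open>br y\<close> for \<open>c\<close> by
  \<open>cnj c\<close>. Conjugation makes the trace of \<open>br y\<close> composed with
  \<open>S\<close> a sum of squared absolute values, so its vanishing forces every eigenvalue to be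
  zero; the trace of the square of an operator can vanish without that. Conjugation is also
  additive, which makes \<open>S\<close> a derivation. The operator first serves Cartan's criterion.
  Once the Killing form is nondegenerate, derivations are inner, so \<open>S\<close> is
  \<open>br d\<close> with \<open>d\<close> diagonalizable, and the vanishing trace becomes
  orthogonality to \<open>d\<close>.

  Degree one must be settled separately: polarization and brackets control only \<open>k - 1\<close>
  times the field of degree \<open>k\<close> in direction \<open>[z, x]\<close>, a factor that
  vanishes at \<open>k = 1\<close>.

  The generated algebra is closed under algebraic operations only, so polarization extracts
  coefficients from finitely many values of a scalar \<open>t\<close> instead of differentiating in
  it.\<close>

abbreviation clinear :: "(complex^'n \<Rightarrow> complex^'n) \<Rightarrow> bool" where
  "clinear \<equiv> Vector_Spaces.linear (*s) (*s)"

lemma clinear_iff: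
  "clinear T \<longleftrightarrow> (\<forall>x y. T (x + y) = T x + T y) \<and> (\<forall>c x. T (c *s x) = c *s T x)"
  by (simp add: Vector_Spaces.linear_iff vec.vector_space_axioms)

lemma clinearD:
  assumes "clinear T"
  shows "T (x + y) = T x + T y" "T (c *s x) = c *s T x" "T 0 = 0" "T (x - y) = T x - T y"
    "T (- x) = - T x" "T (sum g A) = (\<Sum>a\<in>A. T (g a))"
proof -
  interpret T: Vector_Spaces.linear "(*s)" "(*s)" T by fact
  show "T (x + y) = T x + T y" "T (c *s x) = c *s T x" "T 0 = 0" "T (x - y) = T x - T y"
    "T (- x) = - T x" "T (sum g A) = (\<Sum>a\<in>A. T (g a))"
    by (simp_all add: T.add T.scale T.diff T.neg T.sum)
qed

lemma clinear_comp: "clinear S \<Longrightarrow> clinear T \<Longrightarrow> clinear (\<lambda>v. S (T v))"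
  by (simp add: clinear_iff)

lemma clinear_funpow: "clinear T \<Longrightarrow> clinear (T ^^ k)"
  by (induction k) (auto simp: clinear_iff)

lemma csubspace_iff: "csubspace S \<longleftrightarrow> vec.subspace S"
  by (auto simp: csubspace_def vec.subspace_def)

definition op_trace :: "(complex^'n \<Rightarrow> complex^'n) \<Rightarrow> complex" where
  "op_trace T = (\<Sum>i\<in>UNIV. T (axis i 1) $ i)"

lemma op_trace_eq_trace: "op_trace T = trace (matrix T)"
  by (simp add: op_trace_def trace_def matrix_def)

lemma op_trace_commute:
  assumes "clinear S" "clinear T"
  shows "op_trace (\<lambda>v. S (T v)) = op_trace (\<lambda>v. T (S v))"
  using matrix_compose_gen[OF assms] matrix_compose_gen[OF assms(2,1)]
    trace_mul_sym[of "matrix S" "matrix T"]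
  by (simp add: op_trace_eq_trace o_def)

lemma op_trace_add: "op_trace (\<lambda>v. S v + T v) = op_trace S + op_trace T"
  by (simp add: op_trace_def sum.distrib)

lemma op_trace_diff: "op_trace (\<lambda>v. S v - T v) = op_trace S - op_trace T"
  by (simp add: op_trace_def sum_subtractf)

lemma op_trace_minus: "op_trace (\<lambda>v. - T v) = - op_trace T"
  by (simp add: op_trace_def sum_negf)

lemma op_trace_scale: "op_trace (\<lambda>v. c *s T v) = c * op_trace T"
  by (simp add: op_trace_def sum_distrib_left)

lemma op_trace_sum: "op_trace (\<lambda>v. \<Sum>a\<in>A. T a v) = (\<Sum>a\<in>A. op_trace (T a))"
  by (subst (2) op_trace_def, subst sum.swap) (simp add: op_trace_def)

lemma op_trace_zero: "op_trace (\<lambda>v. 0) = 0"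
  by (simp add: op_trace_def)

lemma op_trace_rank_one:
  assumes "Vector_Spaces.linear (*s) (*) \<phi>"
  shows "op_trace (\<lambda>v. \<phi> v *s b) = \<phi> b"
proof -
  interpret \<phi>: Vector_Spaces.linear "(*s)" "(*)" \<phi> by fact
  have "\<phi> b = \<phi> (\<Sum>i\<in>UNIV. b $ i *s axis i 1)"
    by (simp add: basis_expansion)
  also have "\<dots> = (\<Sum>i\<in>UNIV. b $ i * \<phi> (axis i 1))"
    by (simp add: \<phi>.sum \<phi>.scale)
  finally show ?thesis by (simp add: op_trace_def mult.commute)
qed

text \<open>The coordinate functionals of \<open>B\<close> write \<open>T\<close> as a sum of rank
  one operators, so the trace is found without comparing matrices in two bases.\<close>

lemma op_trace_diagonal:
  assumes B: "vec.independent B" "vec.span B = UNIV" and T: "clinear T"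
    and eig: "\<And>b. b \<in> B \<Longrightarrow> T b = d b *s b"
  shows "op_trace T = (\<Sum>b\<in>B. d b)"
proof -
  let ?r = "\<lambda>b v. vec.representation B v b"
  have fin: "finite B" using B(1) by (rule vec.finiteI_independent)
  have lin: "Vector_Spaces.linear (*s) (*) (?r b)" for b
    by (rule vec.linear_representation[OF B])
  have "T = (\<lambda>v. \<Sum>b\<in>B. d b *s (?r b v *s b))"
  proof
    fix v
    have "v = (\<Sum>b\<in>B. ?r b v *s b)"
      using vec.sum_representation_eq[OF B(1) _ fin] B(2) by auto
    then have "T v = T (\<Sum>b\<in>B. ?r b v *s b)" by simp
    also have "\<dots> = (\<Sum>b\<in>B. d b *s (?r b v *s b))"
      by (simp add: clinearD(6)[OF T] clinearD(2)[OF T] eig mult.commute)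
    finally show "T v = (\<Sum>b\<in>B. d b *s (?r b v *s b))" .
  qed
  then have "op_trace T = (\<Sum>b\<in>B. d b * op_trace (\<lambda>v. ?r b v *s b))"
    by (simp only: op_trace_sum op_trace_scale)
  also have "\<dots> = (\<Sum>b\<in>B. d b)"
    by (rule sum.cong) (simp_all add: op_trace_rank_one[OF lin] vec.representation_basis[OF B(1)])
  finally show ?thesis .
qed

lemma subspace_projection:
  fixes V :: "(complex^'n) set"
  assumes "vec.subspace V"
  obtains P :: "complex^'n \<Rightarrow> complex^'n"
  where "clinear P" "\<And>v. P v \<in> V" "\<And>v. v \<in> V \<Longrightarrow> P v = v"
proof -
  have "clinear (\<lambda>v::complex^'n. v)" by (simp add: clinear_iff)
  from vec.linear_exists_left_inverse_on[OF this assms] that show ?thesis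
    by (auto simp: inj_on_def)
qed

text \<open>Induction on the rank: if \<open>P\<close> projects onto the range of \<open>N\<close> then \<open>N\<close> and \<open>N \<circ> P\<close> have
  the same trace, and \<open>N \<circ> P\<close> has smaller rank.\<close>
lemma op_trace_nilpotent:
  fixes N :: "complex^'n \<Rightarrow> complex^'n"
  assumes "clinear N" "\<And>v. (N ^^ k) v = 0"
  shows "op_trace N = 0"
  using assms
proof (induction "vec.dim (range N)" arbitrary: N rule: less_induct)
  case less
  note N = clinearD[OF less.prems(1)]
  show ?case
  proof (cases "range N = {0}")
    case True
    then have "N = (\<lambda>v. 0)" by auto
    then show ?thesis by (simp add: op_trace_zero)
  next
    case False
    let ?U = "range N"
    have U: "vec.subspace ?U"
      using vec.linear_subspace_image[OF less.prems(1) vec.subspace_UNIV] .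
    obtain P where P: "clinear P" "\<And>v. P v \<in> ?U" "\<And>v. v \<in> ?U \<Longrightarrow> P v = v"
      using subspace_projection[OF U] by metis
    let ?M = "\<lambda>v. N (P v)"
    have M: "clinear ?M" using less.prems(1) P(1) by (rule clinear_comp)
    \<comment> \<open>Values of \<open>N\<close> lie in \<open>?U\<close>, where \<open>P\<close> is
      the identity, so only the innermost \<open>P\<close> survives. For \<open>j = 0\<close> the
      equation would read \<open>v = P v\<close>.\<close>
    have pow: "(?M ^^ j) v = (N ^^ j) (P v)" if "j > 0" for j v
      using that
    proof (induction j)
      case (Suc j)
      then show ?case
        by (cases j) (simp_all add: P(3))
    qed simp
    have nil: "(?M ^^ k) v = 0" for v
      using pow[of k v] less.prems(2) by (cases "k = 0") auto
    have ranM: "range ?M = N ` ?U" using P(2,3) by (auto simp: image_iff) metis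
    have sub: "vec.subspace (N ` ?U)" using vec.linear_subspace_image[OF less.prems(1) U] .
    have "N ` ?U \<noteq> ?U"
    proof
      \<comment> \<open>The equality would pass to all powers of \<open>N\<close>, although one of
        them is zero.\<close>
      assume eq: "N ` ?U = ?U"
      have "(N ^^ j) ` ?U = ?U" for j
        by (induction j) (simp_all only: funpow.simps image_comp[symmetric] eq image_id id_apply, simp)
      then have "?U \<subseteq> {0}" using less.prems(2) by (metis (mono_tags) image_subset_iff singletonI)
      with False vec.subspace_0[OF U] show False by auto
    qed
    then have "vec.dim (range ?M) < vec.dim ?U"
      using vec.subspace_dim_equal[OF sub U] ranM by (metis image_mono not_le subset_UNIV)
    then have "op_trace ?M = 0" using less.hyps M nil by blast
    moreover have "op_trace N = op_trace (\<lambda>v. P (N v))" by (simp add: P(3))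
    ultimately show ?thesis using op_trace_commute[OF P(1) less.prems(1)] by simp
  qed
qed

lemma locally_nilpotent:
  assumes T: "clinear T" and B: "finite B" "vec.span B = UNIV"
    and loc: "\<And>b. b \<in> B \<Longrightarrow> \<exists>k. (T ^^ k) b = 0"
  shows "\<exists>k. \<forall>v. (T ^^ k) v = 0"
proof -
  obtain f where f: "\<And>b. b \<in> B \<Longrightarrow> (T ^^ f b) b = 0" using loc by metis
  have mono: "(T ^^ (j + i)) v = 0" if "(T ^^ i) v = 0" for i j v
    using that clinearD(3)[OF clinear_funpow[OF T]] by (simp add: funpow_add)
  let ?k = "sum f B"
  have "(T ^^ ?k) b = 0" if b: "b \<in> B" for b
  proof -
    have "f b \<le> ?k" using b B(1) by (simp add: member_le_sum)
    then show ?thesis using mono[OF f[OF b], of "?k - f b"] by simp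
  qed
  moreover have "clinear (\<lambda>v. 0 :: complex^'a)" by (simp add: clinear_iff)
  ultimately have "(T ^^ ?k) v = 0" for v
    using vec.linear_eq_on[OF clinear_funpow[OF T], of "\<lambda>v. 0" v B] B(2) by auto
  then show ?thesis by blast
qed

section \<open>Generalized eigenspaces of a complex operator\<close>

definition gen_eigenspace :: "(complex^'n \<Rightarrow> complex^'n) \<Rightarrow> complex \<Rightarrow> (complex^'n) set" where
  "gen_eigenspace T c = {v. \<exists>k. ((\<lambda>w. T w - c *s w) ^^ k) v = 0}"

context
  fixes T :: "complex^'n \<Rightarrow> complex^'n"
  assumes T: "clinear T"
begin

lemma clinear_shift: "clinear (\<lambda>w. T w - c *s w)"
  using T by (simp add: clinear_iff algebra_simps vector_add_ldistrib)

lemmas shift_pow = clinearD[OF clinear_funpow[OF clinear_shift]]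

lemma shift_pow_zero_mono:
  assumes "((\<lambda>w. T w - c *s w) ^^ k) v = 0" "k \<le> l"
  shows "((\<lambda>w. T w - c *s w) ^^ l) v = 0"
proof -
  have "((\<lambda>w. T w - c *s w) ^^ (l - k + k)) v = 0"
    unfolding funpow_add using assms(1) by (simp add: shift_pow)
  with assms(2) show ?thesis by simp
qed

lemma subspace_gen_eigenspace: "vec.subspace (gen_eigenspace T c)"
  unfolding vec.subspace_def
proof (intro conjI ballI allI)
  show "0 \<in> gen_eigenspace T c"
    by (auto simp: gen_eigenspace_def intro: exI[of _ 0])
next
  fix x y assume "x \<in> gen_eigenspace T c" "y \<in> gen_eigenspace T c"
  then obtain k l where "((\<lambda>w. T w - c *s w) ^^ k) x = 0" "((\<lambda>w. T w - c *s w) ^^ l) y = 0"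
    by (auto simp: gen_eigenspace_def)
  then have "((\<lambda>w. T w - c *s w) ^^ max k l) (x + y) = 0"
    using shift_pow_zero_mono[of k c x "max k l"] shift_pow_zero_mono[of l c y "max k l"]
    by (simp add: shift_pow)
  then show "x + y \<in> gen_eigenspace T c" by (auto simp: gen_eigenspace_def)
next
  fix a x assume "x \<in> gen_eigenspace T c"
  then obtain k where "((\<lambda>w. T w - c *s w) ^^ k) x = 0"
    by (auto simp: gen_eigenspace_def)
  then have "((\<lambda>w. T w - c *s w) ^^ k) (a *s x) = 0" by (simp add: shift_pow)
  then show "a *s x \<in> gen_eigenspace T c" by (auto simp: gen_eigenspace_def)
qed

lemma gen_eigenspace_shiftI: "T v - c *s v \<in> gen_eigenspace T c \<Longrightarrow> v \<in> gen_eigenspace T c"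
  by (auto simp: gen_eigenspace_def funpow_Suc_right simp del: funpow.simps
      intro: exI[of _ "Suc _"])

lemma gen_eigenspace_shift: "v \<in> gen_eigenspace T c \<Longrightarrow> T v - c *s v \<in> gen_eigenspace T c"
proof -
  assume "v \<in> gen_eigenspace T c"
  then obtain k where "((\<lambda>w. T w - c *s w) ^^ k) v = 0" by (auto simp: gen_eigenspace_def)
  then have "((\<lambda>w. T w - c *s w) ^^ Suc k) v = 0" by (rule shift_pow_zero_mono) simp
  then show ?thesis
    by (auto simp: gen_eigenspace_def funpow_Suc_right simp del: funpow.simps)
qed

lemma gen_eigenspace_shift_any:
  assumes "v \<in> gen_eigenspace T c" shows "T v - a *s v \<in> gen_eigenspace T c"
proof -
  have "T v - a *s v = (T v - c *s v) + (c - a) *s v" by (simp add: algebra_simps vector_sub_rdistrib)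
  then show ?thesis
    using assms gen_eigenspace_shift subspace_gen_eigenspace vec.subspace_add vec.subspace_scale
    by metis
qed

lemma gen_eigenspace_shift_inj:
  assumes "v \<in> gen_eigenspace T c" "T v - a *s v = 0" "a \<noteq> c"
  shows "v = 0"
proof -
  obtain k where k: "((\<lambda>w. T w - c *s w) ^^ k) v = 0" using assms(1) by (auto simp: gen_eigenspace_def)
  have Tv: "T v = a *s v" using assms(2) by simp
  have "((\<lambda>w. T w - c *s w) ^^ j) v = (a - c) ^ j *s v" for j
    by (induction j) (simp_all add: clinearD[OF T] Tv vector_sub_rdistrib algebra_simps)
  with k assms(3) show ?thesis by (simp add: vec.scale_eq_0_iff)
qed

text \<open>On this space \<open>T - a\<close> is the nonzero scalar \<open>c - a\<close> plus the
  nilpotent \<open>T - c\<close>. The induction on the nilpotency exponent unrolls the geometric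
  series of its inverse.\<close>

lemma gen_eigenspace_shift_surj:
  assumes "v \<in> gen_eigenspace T c" "a \<noteq> c"
  shows "\<exists>u\<in>gen_eigenspace T c. T u - a *s u = v"
proof -
  obtain k where "((\<lambda>w. T w - c *s w) ^^ k) v = 0" using assms(1) by (auto simp: gen_eigenspace_def)
  then show ?thesis using assms(1)
  proof (induction k arbitrary: v)
    case 0
    then show ?case
      using vec.subspace_0[OF subspace_gen_eigenspace] by (auto intro!: bexI[of _ 0] simp: clinearD[OF T])
  next
    case (Suc k)
    let ?w = "T v - c *s v"
    have "((\<lambda>w. T w - c *s w) ^^ k) ?w = 0"
      using Suc.prems(1) by (simp add: funpow_Suc_right del: funpow.simps)
    with Suc.IH gen_eigenspace_shift[OF Suc.prems(2)]
    obtain u where u: "u \<in> gen_eigenspace T c" "T u - a *s u = ?w" by blast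
    let ?u = "inverse (c - a) *s (v - u)"
    have "v - u \<in> gen_eigenspace T c"
      using vec.subspace_diff[OF subspace_gen_eigenspace Suc.prems(2) u(1)] .
    then have "?u \<in> gen_eigenspace T c"
      by (rule vec.subspace_scale[OF subspace_gen_eigenspace])
    moreover have "T ?u - a *s ?u = v"
    proof -
      have "T ?u - a *s ?u = inverse (c - a) *s ((T v - a *s v) - (T u - a *s u))"
        by (simp add: clinearD[OF T] vec.scale_right_diff_distrib mult.commute algebra_simps)
      also have "(T v - a *s v) - (T u - a *s u) = (c - a) *s v"
        unfolding u(2) by (simp add: vector_sub_rdistrib)
      also have "inverse (c - a) *s ((c - a) *s v) = (inverse (c - a) * (c - a)) *s v"
        by (rule vec.scale_scale)
      also have "inverse (c - a) * (c - a) = 1" using assms(2) by simp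
      finally show ?thesis by simp
    qed
    ultimately show ?case by blast
  qed
qed

text \<open>A power of \<open>T - a\<close> that kills the component at \<open>a\<close> is
  injective on every other generalized eigenspace, so applying it to the relation removes one
  eigenvalue at a time.\<close>

lemma gen_eigenspaces_independent:
  assumes "finite M" "\<And>c. c \<in> M \<Longrightarrow> v c \<in> gen_eigenspace T c" "(\<Sum>c\<in>M. v c) = 0" "c \<in> M"
  shows "v c = 0"
  using assms
proof (induction M arbitrary: v c rule: finite_induct)
  case (insert a M)
  obtain k where k: "((\<lambda>w. T w - a *s w) ^^ k) (v a) = 0"
    using insert.prems(1)[of a] by (auto simp: gen_eigenspace_def)
  let ?D = "(\<lambda>w. T w - a *s w) ^^ k"
  have inv: "((\<lambda>w. T w - a *s w) ^^ j) u \<in> gen_eigenspace T c" if "u \<in> gen_eigenspace T c" for j u c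
    using that by (induction j) (auto intro: gen_eigenspace_shift_any)
  have "?D (\<Sum>c\<in>insert a M. v c) = 0" by (simp only: insert.prems(2) shift_pow)
  then have "(\<Sum>c\<in>M. ?D (v c)) = 0"
    using insert.hyps k by (simp add: shift_pow)
  then have Dz: "?D (v c) = 0" if "c \<in> M" for c
    using insert.IH[of "\<lambda>c. ?D (v c)" c] that insert.prems(1) inv by auto
  have inj: "u = 0" if "((\<lambda>w. T w - a *s w) ^^ j) u = 0" "u \<in> gen_eigenspace T c" "c \<noteq> a" for j u c
    using that
  proof (induction j)
    case (Suc j)
    then show ?case using gen_eigenspace_shift_inj[OF inv[OF Suc.prems(2), of j], of a] by simp
  qed simp
  have vz: "v c = 0" if "c \<in> M" for c
    using inj[OF Dz[OF that]] insert.prems(1) insert.hyps(2) that by auto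
  then have "v a = 0" using insert.prems(2) insert.hyps by simp
  with vz insert.prems(3) show ?case by auto
qed simp

text \<open>Given \<open>(T - a) v\<close> in the sum of the generalized eigenspaces, its components for eigenvalues
  other than \<open>a\<close> can be divided by \<open>T - a\<close>, and the rest of \<open>v\<close> lies in the space for \<open>a\<close>.\<close>
lemma span_gen_eigenspaces_shiftI:
  assumes "T v - a *s v \<in> vec.span (\<Union>c. gen_eigenspace T c)"
  shows "v \<in> vec.span (\<Union>c. gen_eigenspace T c)"
proof -
  let ?E = "vec.span (\<Union>c. gen_eigenspace T c)"
  have "\<exists>u\<in>?E. w - (T u - a *s u) \<in> gen_eigenspace T a" if "w \<in> ?E" for w
    using that
  proof (induction rule: vec.span_induct_alt)
    case base
    then show ?case
      using vec.subspace_0[OF subspace_gen_eigenspace]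
      by (intro bexI[of _ 0]) (auto simp: clinearD[OF T] vec.span_zero)
  next
    case (step d x y)
    then obtain u c where u: "u \<in> ?E" "y - (T u - a *s u) \<in> gen_eigenspace T a"
      and x: "x \<in> gen_eigenspace T c" by blast
    show ?case
    proof (cases "c = a")
      case True
      have "d *s x + y - (T u - a *s u) = d *s x + (y - (T u - a *s u))" by simp
      also have "\<dots> \<in> gen_eigenspace T a"
        using x u True by (simp add: subspace_gen_eigenspace vec.subspace_add vec.subspace_scale)
      finally show ?thesis using u(1) by blast
    next
      case False
      then obtain z where z: "z \<in> gen_eigenspace T c" "T z - a *s z = x"
        using gen_eigenspace_shift_surj[OF x] by metis
      have "z \<in> ?E" using z(1) by (auto intro: vec.span_base)
      then have "d *s z + u \<in> ?E" using u(1) by (simp add: vec.span_add vec.span_scale)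
      moreover have "d *s x + y - (T (d *s z + u) - a *s (d *s z + u)) = y - (T u - a *s u)"
        by (simp add: z(2)[symmetric] clinearD[OF T] vec.scale_right_diff_distrib
            vec.scale_right_distrib mult.commute)
      ultimately show ?thesis using u(2) by metis
    qed
  qed
  then obtain u where u: "u \<in> ?E" "(T v - a *s v) - (T u - a *s u) \<in> gen_eigenspace T a"
    using assms by blast
  have "(T v - a *s v) - (T u - a *s u) = T (v - u) - a *s (v - u)"
    by (simp add: clinearD[OF T] vec.scale_right_diff_distrib)
  then have "v - u \<in> gen_eigenspace T a" using u(2) gen_eigenspace_shiftI by metis
  then have "v - u \<in> ?E" by (auto intro: vec.span_base)
  then show ?thesis using vec.span_add[OF _ u(1), of "v - u"] by simp
qed

definition poly_op :: "complex poly \<Rightarrow> complex^'n \<Rightarrow> complex^'n" where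
  "poly_op p v = (\<Sum>i\<le>degree p. coeff p i *s (T ^^ i) v)"

lemma poly_op_eq: "degree p \<le> n \<Longrightarrow> poly_op p v = (\<Sum>i\<le>n. coeff p i *s (T ^^ i) v)"
  unfolding poly_op_def
  by (rule sum.mono_neutral_left) (auto simp: coeff_eq_0)

text \<open>Moves a linear factor of the polynomial onto the vector, the form in which
  \<open>span_gen_eigenspaces_shiftI\<close> can undo it.\<close>

lemma poly_op_linear_factor: "poly_op ([:- a, 1:] * q) v = poly_op q (T v - a *s v)"
proof -
  let ?n = "Suc (degree q)"
  note Tk = clinearD[OF clinear_funpow[OF T]]
  have p: "[:- a, 1:] * q = smult (- a) q + pCons 0 q" by simp
  have "degree ([:- a, 1:] * q) \<le> ?n"
    using degree_mult_le[of "[:- a, 1:]" q] by simp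
  then have "poly_op ([:- a, 1:] * q) v
      = (\<Sum>i\<le>?n. coeff (smult (- a) q + pCons 0 q) i *s (T ^^ i) v)"
    using poly_op_eq p by metis
  also have "\<dots> = (\<Sum>i\<le>?n. (- a * coeff q i) *s (T ^^ i) v)
      + (\<Sum>i\<le>?n. coeff (pCons 0 q) i *s (T ^^ i) v)"
    by (simp only: coeff_add coeff_smult vec.scale_left_distrib sum.distrib)
  also have "(\<Sum>i\<le>?n. (- a * coeff q i) *s (T ^^ i) v) = (\<Sum>i\<le>degree q. (- a * coeff q i) *s (T ^^ i) v)"
    by (simp add: coeff_eq_0)
  also have "(\<Sum>i\<le>?n. coeff (pCons 0 q) i *s (T ^^ i) v) = (\<Sum>i\<le>degree q. coeff q i *s (T ^^ i) (T v))"
    by (subst sum.atMost_Suc_shift) (simp add: funpow_Suc_right del: funpow.simps)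
  finally show ?thesis
    unfolding poly_op_def
    by (simp add: Tk sum.distrib[symmetric] vec.scale_right_diff_distrib mult.commute
        add.commute[of "- _"])
qed

text \<open>Linear dependence among the iterates of \<open>T\<close> on \<open>v\<close> gives a
  nonzero polynomial that annihilates \<open>v\<close>. Over the complex numbers it splits into
  linear factors, and induction on the degree strips them one by one.\<close>

lemma span_gen_eigenspaces: "vec.span (\<Union>c. gen_eigenspace T c) = UNIV"
proof -
  have ann: "v \<in> vec.span (\<Union>c. gen_eigenspace T c)" if "p \<noteq> 0" "poly_op p v = 0" for p v
    using that
  proof (induction "degree p" arbitrary: p v)
    case 0
    then obtain c where "p = [:c:]" "c \<noteq> 0" by (metis degree_eq_zeroE pCons_eq_0_iff)
    with 0(3) have "v = 0" by (simp add: poly_op_def vec.scale_eq_0_iff)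
    then show ?case by (simp add: vec.span_zero)
  next
    case (Suc d)
    then have "\<not> constant (poly p)" by (simp add: constant_degree)
    then obtain a where "poly p a = 0" using fundamental_theorem_of_algebra by blast
    then obtain q where q: "p = [:- a, 1:] * q" by (auto simp: poly_eq_0_iff_dvd)
    with Suc.prems have "q \<noteq> 0" by auto
    then have "degree q = d" using Suc.hyps(2) degree_mult_eq[of "[:- a, 1:]" q] by (simp add: q)
    then show ?case
      using Suc.hyps(1)[of q "T v - a *s v"] Suc.prems(2) \<open>q \<noteq> 0\<close> q poly_op_linear_factor
        span_gen_eigenspaces_shiftI by metis
  qed
  have "\<exists>p. p \<noteq> 0 \<and> poly_op p v = 0" for v
  proof -
    let ?W = "\<lambda>m. (\<lambda>i. (T ^^ i) v) ` {..<m}"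
    have "\<exists>m. (T ^^ m) v \<in> vec.span (?W m)"
    proof (rule ccontr)
      \<comment> \<open>Each new iterate would raise the dimension by one, past that of the whole
        space.\<close>
      assume "\<nexists>m. (T ^^ m) v \<in> vec.span (?W m)"
      then have "vec.dim (?W m) = m" for m
        by (induction m) (auto simp: lessThan_Suc vec.dim_insert)
      then show False
        using vec.dim_subset_UNIV[of "?W (Suc CARD('n))"] vec.dimension_def
        by (metis card_cart_basis not_less_eq_eq order_refl)
    qed
    then obtain m where m: "(T ^^ m) v \<in> vec.span (?W m)" by blast
    have "\<exists>c. w = (\<Sum>i<m. c i *s (T ^^ i) v)" if "w \<in> vec.span (?W m)" for w
      using that
    proof (induction rule: vec.span_induct_alt)
      case base
      then show ?case by (intro exI[of _ "\<lambda>_. 0"]) simp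
    next
      case (step d x y)
      then obtain j c where j: "j < m" "x = (T ^^ j) v" and c: "y = (\<Sum>i<m. c i *s (T ^^ i) v)"
        by auto
      have "(\<Sum>i<m. (c i + (if i = j then d else 0)) *s (T ^^ i) v)
          = y + (\<Sum>i<m. if i = j then d *s (T ^^ i) v else 0)"
        unfolding c vec.scale_left_distrib sum.distrib by (intro arg_cong2[where f="(+)"] sum.cong) auto
      also have "\<dots> = d *s x + y" using j by simp
      finally show ?case by (intro exI[of _ "\<lambda>i. c i + (if i = j then d else 0)"]) simp
    qed
    then obtain c where c: "(T ^^ m) v = (\<Sum>i<m. c i *s (T ^^ i) v)" using m by blast
    let ?p = "monom 1 m - (\<Sum>i<m. monom (c i) i)"
    have co: "coeff ?p i = (if i = m then 1 else if i < m then - c i else 0)" for i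
      by (auto simp: coeff_sum)
    have "degree ?p \<le> m" by (rule degree_le, intro allI impI, subst co) simp
    then have "poly_op ?p v = (\<Sum>i\<le>m. coeff ?p i *s (T ^^ i) v)" by (rule poly_op_eq)
    also have "\<dots> = (\<Sum>i<m. (- c i) *s (T ^^ i) v) + (T ^^ m) v"
      unfolding lessThan_Suc_atMost[symmetric] sum.lessThan_Suc co by simp
    also have "\<dots> = 0" unfolding c by (simp add: sum_negf)
    finally have "poly_op ?p v = 0" .
    moreover have "?p \<noteq> 0" using co[of m] by (metis coeff_0 zero_neq_one)
    ultimately show ?thesis by blast
  qed
  with ann show ?thesis by blast
qed

lemma gen_eigenbasis:
  obtains B lam where "vec.independent B" "vec.span B = UNIV"
    "\<And>b. b \<in> B \<Longrightarrow> b \<in> gen_eigenspace T (lam b)"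
proof -
  obtain B where B: "B \<subseteq> (\<Union>c. gen_eigenspace T c)" "vec.independent B"
    "(\<Union>c. gen_eigenspace T c) \<subseteq> vec.span B"
    by (rule vec.maximal_independent_subset)
  have "vec.span B = UNIV"
    using span_gen_eigenspaces vec.span_mono[OF B(3)] by (auto simp: vec.span_span)
  moreover obtain lam where "\<And>b. b \<in> B \<Longrightarrow> b \<in> gen_eigenspace T (lam b)" using B(1) by (metis UN_E subsetD)
  ultimately show ?thesis using B(2) that by blast
qed

text \<open>The operator is \<open>h\<close> of the semisimple part of \<open>T\<close>, but it is
  prescribed only on a basis. When the coordinates of \<open>v\<close> are grouped by eigenvalue,
  independence leaves just the group of \<open>c\<close>.\<close>

lemma construct_eigenvalues:
  assumes B: "vec.independent B" "vec.span B = UNIV"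
    and lam: "\<And>b. b \<in> B \<Longrightarrow> b \<in> gen_eigenspace T (lam b)"
    and v: "v \<in> gen_eigenspace T c"
  shows "vec.construct B (\<lambda>b. h (lam b) *s b) v = h c *s v"
proof -
  let ?S = "vec.construct B (\<lambda>b. h (lam b) *s b)"
  let ?r = "vec.representation B v"
  have fin: "finite B" using B(1) by (rule vec.finiteI_independent)
  have S: "clinear ?S" using B(1) by (rule vec.linear_construct)
  have v_eq: "(\<Sum>b\<in>B. ?r b *s b) = v"
    using vec.sum_representation_eq[OF B(1) _ fin] B(2) by auto
  let ?w = "\<lambda>a. \<Sum>b\<in>{b\<in>B. lam b = a}. ?r b *s b"
  \<comment> \<open>\<open>c\<close> is inserted since no basis vector need have it as its
    eigenvalue; \<open>v\<close> is then zero.\<close>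
  let ?M = "insert c (lam ` B)"
  have w: "?w a \<in> gen_eigenspace T a" for a
    by (rule vec.subspace_sum[OF subspace_gen_eigenspace])
      (auto intro: vec.subspace_scale[OF subspace_gen_eigenspace] lam)
  have w_sum: "(\<Sum>a\<in>?M. ?w a) = v"
    using sum.group[OF fin, of ?M lam "\<lambda>b. ?r b *s b"] fin v_eq by auto
  \<comment> \<open>Subtracting \<open>v\<close> from the group of \<open>c\<close> turns the
    decomposition into a vanishing sum, to which independence applies.\<close>
  let ?u = "\<lambda>a. ?w a - (if a = c then v else 0)"
  have "?u a = 0" if "a \<in> ?M" for a
  proof (rule gen_eigenspaces_independent[of ?M ?u, OF _ _ _ that])
    show "finite ?M" using fin by simp
    show "?u a \<in> gen_eigenspace T a" for a
      using w v vec.subspace_diff[OF subspace_gen_eigenspace] vec.subspace_0[OF subspace_gen_eigenspace]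
      by auto
    show "(\<Sum>a\<in>?M. ?u a) = 0"
      unfolding sum_subtractf w_sum using fin by (simp add: sum.delta)
  qed
  then have "?w a = (if a = c then v else 0)" if "a \<in> ?M" for a
    using that unfolding right_minus_eq .
  then have wz: "h a *s ?w a = (if a = c then h c *s v else 0)" if "a \<in> ?M" for a
    using that by (cases "a = c") (simp_all only: refl if_True if_False vec.scale_zero_right)
  have "?S v = ?S (\<Sum>b\<in>B. ?r b *s b)" by (simp only: v_eq)
  also have "\<dots> = (\<Sum>b\<in>B. h (lam b) *s (?r b *s b))"
    by (simp add: clinearD(6,2)[OF S] vec.construct_basis[OF B(1)] mult.commute)
  also have "\<dots> = (\<Sum>a\<in>?M. \<Sum>b\<in>{b\<in>B. lam b = a}. h (lam b) *s (?r b *s b))"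
    by (rule sum.group[symmetric]) (use fin in auto)
  also have "\<dots> = (\<Sum>a\<in>?M. h a *s ?w a)"
    by (intro sum.cong refl) (simp add: vec.scale_sum_right)
  also have "\<dots> = (\<Sum>a\<in>?M. if a = c then h c *s v else 0)"
    using wz by (intro sum.cong refl) blast
  also have "\<dots> = h c *s v" using fin by (simp add: sum.delta)
  finally show ?thesis .
qed

text \<open>The trace of \<open>T \<circ> S\<close> is the sum of the squared absolute values of the eigenvalues of \<open>T\<close>.\<close>
lemma conjugate_semisimple_part:
  obtains S B lam where "clinear S" "vec.independent B" "vec.span B = UNIV"
    "\<And>b. b \<in> B \<Longrightarrow> b \<in> gen_eigenspace T (lam b)"
    "\<And>c v. v \<in> gen_eigenspace T c \<Longrightarrow> S v = cnj c *s v"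
    "op_trace (\<lambda>v. T (S v)) = 0 \<Longrightarrow> \<exists>k. \<forall>v. (T ^^ k) v = 0"
proof -
  obtain B lam where B: "vec.independent B" "vec.span B = UNIV"
    and lam: "\<And>b. b \<in> B \<Longrightarrow> b \<in> gen_eigenspace T (lam b)"
    using gen_eigenbasis by blast
  let ?S = "vec.construct B (\<lambda>b. cnj (lam b) *s b)"
  let ?D = "vec.construct B (\<lambda>b. (lam b) *s b)"
  have fin: "finite B" using B(1) by (rule vec.finiteI_independent)
  have S: "clinear ?S" and D: "clinear ?D" using B(1) by (auto intro: vec.linear_construct)
  have S_eig: "?S v = cnj c *s v" and D_eig: "?D v = c *s v" if "v \<in> gen_eigenspace T c" for c v
    using construct_eigenvalues[OF B lam that, of cnj] construct_eigenvalues[OF B lam that, of "\<lambda>x. x"]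
    by auto
  \<comment> \<open>On the space for \<open>c\<close> this is \<open>cnj c\<close> times the
    nilpotent \<open>T - c\<close>. Hence it has trace zero, and under the trace \<open>T\<close>
    may be replaced by its semisimple part \<open>?D\<close>.\<close>
  let ?N = "\<lambda>v. T (?S v) - ?D (?S v)"
  have N: "clinear ?N"
    using clinear_comp[OF T S] clinear_comp[OF D S] by (rule vec.linear_compose_sub)
  have N_pow: "(?N ^^ k) v = cnj c ^ k *s ((\<lambda>w. T w - c *s w) ^^ k) v"
    if v: "v \<in> gen_eigenspace T c" for k c v
  proof (induction k)
    case (Suc k)
    have "((\<lambda>w. T w - c *s w) ^^ k) v \<in> gen_eigenspace T c"
      using v by (induction k) (auto intro: gen_eigenspace_shift)
    then show ?case
      by (simp add: Suc clinearD[OF S] clinearD[OF T] clinearD[OF D] S_eig D_eig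
          vec.scale_right_diff_distrib algebra_simps)
  qed simp
  have loc: "\<exists>k. (?N ^^ k) b = 0" if b: "b \<in> B" for b
  proof -
    obtain k where "((\<lambda>w. T w - lam b *s w) ^^ k) b = 0"
      using lam[OF b] by (auto simp: gen_eigenspace_def)
    then have "(?N ^^ k) b = 0" using N_pow[OF lam[OF b], of k] by simp
    then show ?thesis by blast
  qed
  obtain k where "\<And>v. (?N ^^ k) v = 0"
    using locally_nilpotent[OF N fin B(2) loc] by blast
  then have "op_trace ?N = 0" using op_trace_nilpotent[OF N] by blast
  then have "op_trace (\<lambda>v. T (?S v)) = op_trace (\<lambda>v. ?D (?S v))" by (simp add: op_trace_diff)
  also have "\<dots> = (\<Sum>b\<in>B. of_real ((cmod (lam b))\<^sup>2))"
  proof (rule op_trace_diagonal[OF B clinear_comp[OF D S]])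
    show "?D (?S b) = of_real ((cmod (lam b))\<^sup>2) *s b" if "b \<in> B" for b
      using S_eig[OF lam[OF that]] D_eig[OF lam[OF that]]
      by (simp add: clinearD[OF D] complex_norm_square mult.commute del: of_real_power)
  qed
  finally have tr: "op_trace (\<lambda>v. T (?S v)) = of_real (\<Sum>b\<in>B. (cmod (lam b))\<^sup>2)" by simp
  have "\<exists>k. \<forall>v. (T ^^ k) v = 0" if "op_trace (\<lambda>v. T (?S v)) = 0"
  proof -
    have "(\<Sum>b\<in>B. (cmod (lam b))\<^sup>2) = 0" using tr that by (metis of_real_eq_0_iff)
    then have "lam b = 0" if "b \<in> B" for b using fin that by (simp add: sum_nonneg_eq_0_iff)
    then have "\<exists>k. (T ^^ k) b = 0" if "b \<in> B" for b
      using lam[OF that] that by (auto simp: gen_eigenspace_def)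
    then show ?thesis by (rule locally_nilpotent[OF T fin B(2)])
  qed
  then show ?thesis using that[OF S B lam S_eig] by blast
qed

end

section \<open>Semisimple Lie algebras\<close>

locale lie_alg =
  fixes br :: "complex^'n \<Rightarrow> complex^'n \<Rightarrow> complex^'n"
  assumes lie_algebra: "lie_algebra br"
begin

lemma br_add_left: "br (x + y) z = br x z + br y z"
  and br_add_right: "br x (y + z) = br x y + br x z"
  and br_scale_left: "br (c *s x) y = c *s br x y"
  and br_scale_right: "br x (c *s y) = c *s br x y"
  and br_self: "br x x = 0"
  using lie_algebra by (simp_all add: lie_algebra_def)

lemma br_anti: "br x y = - br y x"
proof -
  have "0 = br (x + y) (x + y)" by (simp add: br_self)
  also have "\<dots> = br x y + br y x" by (simp only: br_add_left br_add_right) (simp add: br_self)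
  finally show ?thesis by (simp add: eq_neg_iff_add_eq_0)
qed

lemma clinear_ad: "clinear (br x)"
  by (simp add: clinear_iff br_add_right br_scale_right)

lemma clinear_ad_left: "clinear (\<lambda>x. br x y)"
  by (simp add: clinear_iff br_add_left br_scale_left)

lemmas br_right = clinearD[OF clinear_ad]
lemmas br_left = clinearD[OF clinear_ad_left]

lemma jacobi: "br (br x y) z = br x (br y z) - br y (br x z)"
proof -
  have "br x (br y z) + br y (br z x) + br z (br x y) = 0"
    using lie_algebra by (simp add: lie_algebra_def)
  moreover have "br y (br z x) = - br y (br x z)" by (subst br_anti[of z x]) (simp add: br_right)
  moreover have "br z (br x y) = - br (br x y) z" by (rule br_anti)
  ultimately show ?thesis by (simp add: algebra_simps)
qed

section \<open>Killing form and derivations\<close>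

definition killing :: "complex^'n \<Rightarrow> complex^'n \<Rightarrow> complex" where
  "killing x y = op_trace (\<lambda>v. br x (br y v))"

lemma killing_sym: "killing x y = killing y x"
  unfolding killing_def by (rule op_trace_commute[OF clinear_ad clinear_ad])

lemma killing_left: "killing (x + y) z = killing x z + killing y z"
  "killing (c *s x) z = c * killing x z"
  "killing 0 z = 0"
  by (simp_all add: killing_def br_left op_trace_add op_trace_scale op_trace_zero)

lemma killing_right: "killing z (x + y) = killing z x + killing z y"
  "killing z (c *s x) = c * killing z x"
  "killing z 0 = 0"
  by (simp_all only: killing_sym[of z] killing_left)

lemma killing_minus: "killing (- x) y = - killing x y" "killing x (- y) = - killing x y"
  using killing_left(2)[of "-1" x y] killing_right(2)[of x "-1" y] by simp_all

definition derivation :: "(complex^'n \<Rightarrow> complex^'n) \<Rightarrow> bool" where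
  "derivation \<delta> \<longleftrightarrow> clinear \<delta> \<and> (\<forall>x y. \<delta> (br x y) = br (\<delta> x) y + br x (\<delta> y))"

lemma derivation_ad: "derivation (br x)"
  by (simp add: derivation_def clinear_ad jacobi)

lemma derivation_diff: "derivation \<delta> \<Longrightarrow> derivation \<epsilon> \<Longrightarrow> derivation (\<lambda>x. \<delta> x - \<epsilon> x)"
  by (auto simp: derivation_def br_left br_right intro: vec.linear_compose_sub)

text \<open>Cyclicity of the trace leaves \<open>br a\<close> composed with the commutator of
  \<open>br b\<close> and \<open>\<delta>\<close>, which is \<open>- br (\<delta> b)\<close>. Inner
  \<open>\<delta>\<close> gives invariance of the Killing form; general \<open>\<delta>\<close>
  serves Cartan's criterion.\<close>

lemma trace_ad_derivation:
  assumes "derivation \<delta>"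
  shows "op_trace (\<lambda>v. br (br a b) (\<delta> v)) = - killing a (\<delta> b)"
proof -
  have \<delta>: "clinear \<delta>" and der: "\<And>x y. \<delta> (br x y) = br (\<delta> x) y + br x (\<delta> y)"
    using assms by (auto simp: derivation_def)
  have "op_trace (\<lambda>v. br (br a b) (\<delta> v))
      = op_trace (\<lambda>v. br a (br b (\<delta> v))) - op_trace (\<lambda>v. br b (br a (\<delta> v)))"
    by (simp add: jacobi op_trace_diff)
  also have "op_trace (\<lambda>v. br b (br a (\<delta> v))) = op_trace (\<lambda>v. br a (\<delta> (br b v)))"
    using op_trace_commute[OF clinear_ad[of b] clinear_comp[OF clinear_ad[of a] \<delta>]] .
  also have "op_trace (\<lambda>v. br a (br b (\<delta> v))) - op_trace (\<lambda>v. br a (\<delta> (br b v)))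
      = op_trace (\<lambda>v. br a (br b (\<delta> v)) - br a (\<delta> (br b v)))"
    by (simp add: op_trace_diff)
  also have "\<dots> = op_trace (\<lambda>v. - br a (br (\<delta> b) v))" by (simp add: der br_right)
  also have "\<dots> = - killing a (\<delta> b)" by (simp add: killing_def op_trace_minus)
  finally show ?thesis .
qed

lemma killing_invariant: "killing (br x y) z = killing x (br y z)"
proof -
  have "killing (br x y) z = - killing x (br z y)"
    unfolding killing_def[of "br x y"] by (rule trace_ad_derivation[OF derivation_ad])
  then show ?thesis by (simp add: br_anti[of y z] killing_minus)
qed

text \<open>The shift of \<open>\<delta>\<close> by \<open>a + b\<close> obeys a Leibniz rule in
  terms of the shifts by \<open>a\<close> and \<open>b\<close>, each of which lowers one of the two
  nilpotency exponents.\<close>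

lemma gen_eigenspace_br:
  assumes \<delta>: "derivation \<delta>"
    and "x \<in> gen_eigenspace \<delta> a" "y \<in> gen_eigenspace \<delta> b"
  shows "br x y \<in> gen_eigenspace \<delta> (a + b)"
proof -
  have lin: "clinear \<delta>" and der: "\<And>x y. \<delta> (br x y) = br (\<delta> x) y + br x (\<delta> y)"
    using \<delta> by (auto simp: derivation_def)
  note sub = subspace_gen_eigenspace[OF lin]
  obtain k l where "((\<lambda>w. \<delta> w - a *s w) ^^ k) x = 0" "((\<lambda>w. \<delta> w - b *s w) ^^ l) y = 0"
    using assms by (auto simp: gen_eigenspace_def)
  then show ?thesis
  proof (induction "k + l" arbitrary: k l x y)
    case 0
    then show ?case using vec.subspace_0[OF sub] by (simp add: br_left)
  next
    case (Suc n)
    show ?case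
    proof (cases "k = 0 \<or> l = 0")
      case True
      with Suc.prems have "x = 0 \<or> y = 0" by auto
      then show ?thesis using vec.subspace_0[OF sub] by (auto simp: br_left br_right)
    next
      case False
      then obtain k' l' where kl: "k = Suc k'" "l = Suc l'" by (metis not0_implies_Suc)
      have "br (\<delta> x - a *s x) y \<in> gen_eigenspace \<delta> (a + b)"
        using Suc.hyps(1)[of k' l "\<delta> x - a *s x" y] Suc.hyps(2) Suc.prems kl
        by (simp add: funpow_Suc_right del: funpow.simps)
      moreover have "br x (\<delta> y - b *s y) \<in> gen_eigenspace \<delta> (a + b)"
        using Suc.hyps(1)[of k l' x "\<delta> y - b *s y"] Suc.hyps(2) Suc.prems kl
        by (simp add: funpow_Suc_right del: funpow.simps)
      ultimately have "br (\<delta> x - a *s x) y + br x (\<delta> y - b *s y) \<in> gen_eigenspace \<delta> (a + b)"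
        using sub by (rule vec.subspace_add[rotated])
      moreover have "br (\<delta> x - a *s x) y + br x (\<delta> y - b *s y) = \<delta> (br x y) - (a + b) *s br x y"
        by (simp add: der br_left br_right vec.scale_left_distrib)
      ultimately show ?thesis using gen_eigenspace_shiftI[OF lin] by metis
    qed
  qed
qed

section \<open>Ad-nilpotent elements\<close>

definition ad_nilpotent :: "complex^'n \<Rightarrow> bool" where
  "ad_nilpotent x \<longleftrightarrow> (\<exists>k. \<forall>v. (br x ^^ k) v = 0)"

text \<open>Eigenvalues of a derivation add under the bracket. As \<open>cnj\<close> is additive,
  the conjugate part satisfies the Leibniz rule on generalized eigenvectors, and bilinearity extends
  it from the basis.\<close>

lemma ad_conjugate_derivation:
  obtains S B lam where "derivation S" "vec.span B = UNIV"
    "\<And>b. b \<in> B \<Longrightarrow> S b = lam b *s b"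
    "op_trace (\<lambda>v. br y (S v)) = 0 \<Longrightarrow> ad_nilpotent y"
proof (rule conjugate_semisimple_part[OF clinear_ad[of y]])
  fix S B lam
  assume S: "clinear S" and B: "vec.span B = UNIV"
    and lam: "\<And>b. b \<in> B \<Longrightarrow> b \<in> gen_eigenspace (br y) (lam b)"
    and eig: "\<And>c v. v \<in> gen_eigenspace (br y) c \<Longrightarrow> S v = cnj c *s v"
    and tr: "op_trace (\<lambda>v. br y (S v)) = 0 \<Longrightarrow> \<exists>k. \<forall>v. (br y ^^ k) v = 0"
  have BB: "S (br b c) = br (S b) c + br b (S c)" if "b \<in> B" "c \<in> B" for b c
    using eig[OF gen_eigenspace_br[OF derivation_ad lam lam, OF that]]
    by (simp add: eig[OF lam[OF that(1)]] eig[OF lam[OF that(2)]] br_left br_right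
        vec.scale_left_distrib)
  have B1: "S (br b v) = br (S b) v + br b (S v)" if "b \<in> B" for b v
    by (rule vec.linear_eq_on[of "\<lambda>v. S (br b v)" "\<lambda>v. br (S b) v + br b (S v)" v B])
      (use B BB that in \<open>auto simp: clinear_iff clinearD[OF S] br_right vec.scale_right_distrib\<close>)
  have "S (br u v) = br (S u) v + br u (S v)" for u v
    by (rule vec.linear_eq_on[of "\<lambda>u. S (br u v)" "\<lambda>u. br (S u) v + br u (S v)" u B])
      (use B B1 in \<open>auto simp: clinear_iff clinearD[OF S] br_left vec.scale_right_distrib\<close>)
  then have "derivation S" using S by (simp add: derivation_def)
  then show thesis
    using B by (rule that) (use eig lam tr in \<open>auto simp: ad_nilpotent_def\<close>)
qed

text \<open>Engel's theorem, by a maximal subalgebra \<open>K\<close> of \<open>I\<close> for which every proper inclusion of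
  \<open>K\<close>-stable subspaces \<open>A \<subset> B\<close> admits a nonzero \<open>K\<close>-fixed vector in \<open>B / A\<close>.\<close>
lemma engel:
  assumes I: "vec.subspace I" "\<And>x y. x \<in> I \<Longrightarrow> y \<in> I \<Longrightarrow> br x y \<in> I" "I \<noteq> {0}"
    and nil: "\<And>x. x \<in> I \<Longrightarrow> ad_nilpotent x"
  shows "\<exists>v\<in>I. v \<noteq> 0 \<and> (\<forall>x\<in>I. br x v = 0)"
proof -
  \<comment> \<open>Quantifying over all pairs lets one property serve twice: the pair of
    \<open>K\<close> and \<open>I\<close> yields an element normalizing \<open>K\<close>, and the
    pair of \<open>{0}\<close> and \<open>I\<close> yields the conclusion.\<close>
  define P where "P K \<longleftrightarrow> (\<forall>A B. vec.subspace A \<and> vec.subspace B \<and> A \<subset> B \<and>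
      (\<forall>k\<in>K. (\<forall>a\<in>A. br k a \<in> A) \<and> (\<forall>b\<in>B. br k b \<in> B)) \<longrightarrow>
      (\<exists>v\<in>B - A. \<forall>k\<in>K. br k v \<in> A))" for K
  define Q where "Q K \<longleftrightarrow> vec.subspace K \<and> K \<subseteq> I \<and> (\<forall>x\<in>K. \<forall>y\<in>K. br x y \<in> K) \<and> P K" for K
  have "P {0}"
    unfolding P_def by (auto simp: br_left vec.subspace_0)
  then have "Q {0}"
    unfolding Q_def using vec.subspace_0[OF I(1)] by (simp add: br_self)
  moreover have "\<forall>K. Q K \<longrightarrow> vec.dim K < Suc CARD('n)"
    using vec.dim_subset_UNIV vec.dimension_def by (metis card_cart_basis less_Suc_eq_le)
  ultimately obtain K where K: "Q K" and max: "\<And>K'. Q K' \<Longrightarrow> vec.dim K' \<le> vec.dim K"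
    using ex_has_greatest_nat[of Q "{0}" vec.dim] by blast
  have sub: "vec.subspace K" and KI: "K \<subseteq> I" and alg: "\<And>x y. x \<in> K \<Longrightarrow> y \<in> K \<Longrightarrow> br x y \<in> K" and "P K"
    using K by (auto simp: Q_def)
  have "K = I"
  proof (rule ccontr)
    assume "K \<noteq> I"
    then have "\<exists>z\<in>I - K. \<forall>k\<in>K. br k z \<in> K"
      using \<open>P K\<close>[unfolded P_def, rule_format, of K I] sub I(1,2) KI alg by blast
    then obtain z where z: "z \<in> I" "z \<notin> K" and zK: "\<And>k. k \<in> K \<Longrightarrow> br k z \<in> K" by blast
    have zK': "br z k \<in> K" if "k \<in> K" for k
      using zK[OF that] br_anti[of z k] vec.subspace_neg[OF sub] by simp
    define K' where "K' = vec.span (insert z K)"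
    have K'_iff: "x \<in> K' \<longleftrightarrow> (\<exists>c. x - c *s z \<in> K)" for x
      unfolding K'_def vec.span_insert using sub by (simp add: vec.span_eq_iff[THEN iffD2])
    have K'_sub: "vec.subspace K'" unfolding K'_def by (rule vec.subspace_span)
    have K'_elim: "\<exists>k c. k \<in> K \<and> x = k + c *s z" if "x \<in> K'" for x
      using that by (metis K'_iff diff_add_cancel)
    have KK': "K \<subseteq> K'" "z \<in> K'" by (auto simp: K'_def vec.span_base)
    have "P K'"
      unfolding P_def
    proof (intro allI impI, elim conjE)
      fix A B
      assume A: "vec.subspace A" and B: "vec.subspace B" and AB: "A \<subset> B"
        and inv: "\<forall>k\<in>K'. (\<forall>a\<in>A. br k a \<in> A) \<and> (\<forall>b\<in>B. br k b \<in> B)"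
      then have "\<exists>v\<in>B - A. \<forall>k\<in>K. br k v \<in> A"
        using \<open>P K\<close>[unfolded P_def, rule_format, of A B] A B AB KK'(1) by blast
      then obtain v where v: "v \<in> B" "v \<notin> A" "\<And>k. k \<in> K \<Longrightarrow> br k v \<in> A" by blast
      \<comment> \<open>Since \<open>z\<close> normalizes \<open>K\<close>, its iterates carry
        \<open>v\<close> to vectors that \<open>K\<close> still kills modulo
        \<open>A\<close>.\<close>
      have W: "(br z ^^ j) v \<in> B \<and> (\<forall>k\<in>K. br k ((br z ^^ j) v) \<in> A)" for j
      proof (induction j)
        case (Suc j)
        let ?w = "(br z ^^ j) v"
        have "br k (br z ?w) \<in> A" if k: "k \<in> K" for k
        proof -
          have "br k (br z ?w) = br (br k z) ?w + br z (br k ?w)" by (simp add: jacobi)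
          also have "\<dots> \<in> A"
            using Suc zK[OF k] k inv KK' by (intro vec.subspace_add[OF A]) auto
          finally show ?thesis .
        qed
        then show ?case using Suc inv KK' by auto
      qed (use v in auto)
      obtain m where "(br z ^^ m) v \<in> A"
        using nil[OF z(1)] vec.subspace_0[OF A] by (metis ad_nilpotent_def)
      \<comment> \<open>Where the iterates enter \<open>A\<close>, the vector just before is killed
        modulo \<open>A\<close> by \<open>z\<close> as well as by \<open>K\<close>.\<close>
      then obtain j where j: "(br z ^^ j) v \<notin> A" "(br z ^^ Suc j) v \<in> A"
      proof (induction m)
        case 0
        then show ?case using v by simp
      next
        case (Suc m)
        then show ?case by blast
      qed
      have "br x ((br z ^^ j) v) \<in> A" if x: "x \<in> K'" for x
      proof -
        obtain k c where k: "k \<in> K" "x = k + c *s z" using K'_elim[OF x] by blast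
        have "br k ((br z ^^ j) v) + c *s br z ((br z ^^ j) v) \<in> A"
          using W[of j] k(1) j(2) by (intro vec.subspace_add[OF A] vec.subspace_scale[OF A]) auto
        then show ?thesis by (simp add: k(2) br_left)
      qed
      then show "\<exists>v\<in>B - A. \<forall>k\<in>K'. br k v \<in> A" using W[of j] j(1) by blast
    qed
    moreover have "K' \<subseteq> I"
      unfolding K'_def using KI z(1) I(1) by (intro vec.span_minimal) auto
    moreover have "br x y \<in> K'" if xy: "x \<in> K'" "y \<in> K'" for x y
    proof -
      obtain k c l d where *: "k \<in> K" "x = k + c *s z" "l \<in> K" "y = l + d *s z"
        using K'_elim[OF xy(1)] K'_elim[OF xy(2)] by blast
      have "br x y = br k l + d *s br k z + c *s br z l"
        by (simp add: * br_left br_right br_self algebra_simps)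
      also have "\<dots> \<in> K"
        using * alg zK zK' by (intro vec.subspace_add[OF sub] vec.subspace_scale[OF sub]) auto
      finally show ?thesis using KK' by blast
    qed
    ultimately have "Q K'" using K'_sub by (simp add: Q_def)
    from max[OF this] z(2) show False
      unfolding K'_def using sub by (simp add: vec.dim_insert vec.span_eq_iff[THEN iffD2])
  qed
  with \<open>P K\<close> have "P I" by simp
  moreover have "{0} \<subset> I" using I(1,3) vec.subspace_0 by blast
  ultimately have "\<exists>v\<in>I - {0}. \<forall>x\<in>I. br x v \<in> {0}"
    unfolding P_def using I(1,2) by (elim allE[where x = "{0}"] allE[where x = I]) (simp add: br_right)
  then show ?thesis by auto
qed

end

section \<open>Cartan's criterion and its consequences\<close>

locale semisimple_lie_alg = lie_alg +
  assumes no_solvable_ideal: "\<And>I. lie_ideal br I \<Longrightarrow> solvable_sub br I \<Longrightarrow> I = {0}"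
begin

text \<open>Solvability enters here: the derived series of an abelian ideal reaches
  \<open>{0}\<close> after one step.\<close>

lemma abelian_ideal_trivial:
  assumes I: "vec.subspace I" "\<And>x y. x \<in> I \<Longrightarrow> br y x \<in> I"
    and abel: "\<And>x y. x \<in> I \<Longrightarrow> y \<in> I \<Longrightarrow> br x y = 0"
  shows "I = {0}"
proof (rule no_solvable_ideal)
  show "lie_ideal br I" using I by (auto simp: lie_ideal_def csubspace_iff)
  have "{br x y |x y. x \<in> I \<and> y \<in> I} \<subseteq> {0}" using abel by auto
  then have "derived br I (Suc 0) \<subseteq> {0}"
    unfolding derived.simps cspan_def by (intro Inter_lower) (simp add: csubspace_iff)
  moreover have "0 \<in> derived br I (Suc 0)" by (auto simp: cspan_def csubspace_iff vec.subspace_0)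
  ultimately have "derived br I (Suc 0) = {0}" by blast
  then show "solvable_sub br I" unfolding solvable_sub_def by blast
qed

text \<open>By Engel's theorem a nonzero ideal of this kind has nonzero center. By the Jacobi
  identity the center is stable under the whole algebra, hence an abelian ideal.\<close>

lemma nilpotent_ideal_trivial:
  assumes I: "vec.subspace I" "\<And>x y. x \<in> I \<Longrightarrow> br y x \<in> I"
    and nil: "\<And>x. x \<in> I \<Longrightarrow> ad_nilpotent x"
  shows "I = {0}"
proof (rule ccontr)
  assume "I \<noteq> {0}"
  have I': "br x y \<in> I" if "x \<in> I" for x y
    using I(2)[OF that, of y] br_anti[of x y] vec.subspace_neg[OF I(1)] by simp
  obtain v where v: "v \<in> I" "v \<noteq> 0" "\<And>x. x \<in> I \<Longrightarrow> br x v = 0"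
    using engel[OF I(1) I' \<open>I \<noteq> {0}\<close> nil] by blast
  let ?Z = "{v \<in> I. \<forall>x\<in>I. br x v = 0}"
  have "?Z = {0}"
  proof (rule abelian_ideal_trivial)
    show "vec.subspace ?Z"
      using I(1) by (auto simp: vec.subspace_def br_right)
    show "br y z \<in> ?Z" if z: "z \<in> ?Z" for y z
    proof -
      have "br x (br y z) = 0" if x: "x \<in> I" for x
      proof -
        have "br x (br y z) = br (br x y) z + br y (br x z)" by (simp add: jacobi)
        then show ?thesis using z x I'[OF x] by (simp add: br_right)
      qed
      with z I(2) show ?thesis by auto
    qed
  qed auto
  with v show False by blast
qed

text \<open>On brackets \<open>br a b\<close> with \<open>a\<close> in the radical
  \<open>?N\<close>, \<open>trace_ad_derivation\<close> reduces the trace to a Killing product with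
  \<open>a\<close>. So it is the ideal spanned by these brackets that is shown nilpotent; once it is
  zero, the radical is central and therefore abelian.\<close>

lemma killing_nondegenerate:
  assumes "\<And>z. killing y z = 0"
  shows "y = 0"
proof -
  let ?N = "{y. \<forall>z. killing y z = 0}"
  have N: "vec.subspace ?N" by (auto simp: vec.subspace_def killing_left)
  have N_ideal: "br x a \<in> ?N" if "a \<in> ?N" for a x
    using that by (auto simp: br_anti[of x a] killing_minus killing_invariant)
  let ?G = "{br a b |a b. a \<in> ?N}"
  let ?I = "vec.span ?G"
  have "?I = {0}"
  proof (rule nilpotent_ideal_trivial)
    show "vec.subspace ?I" by (rule vec.subspace_span)
    fix x assume "x \<in> ?I"
    show "br y x \<in> ?I" for y
      using \<open>x \<in> ?I\<close>
    proof (induction rule: vec.span_induct_alt)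
      case base
      then show ?case by (simp add: br_right vec.span_zero)
    next
      case (step c g w)
      then obtain a b where g: "g = br a b" "a \<in> ?N" by blast
      have "br y g = br (br y a) b + br a (br y b)" by (simp add: g(1) jacobi)
      also have "\<dots> \<in> ?I"
        using N_ideal g(2) by (intro vec.span_add vec.span_base) blast+
      finally have "c *s br y g + br y w \<in> ?I" using step.IH by (intro vec.span_add vec.span_scale)
      then show ?case by (simp add: br_right)
    qed
    show "ad_nilpotent x"
    proof (rule ad_conjugate_derivation[of x])
      fix S :: "complex^'a \<Rightarrow> complex^'a"
      assume S: "derivation S"
        and tr: "op_trace (\<lambda>v. br x (S v)) = 0 \<Longrightarrow> ad_nilpotent x"
      have "op_trace (\<lambda>v. br x (S v)) = 0"
        using \<open>x \<in> ?I\<close>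
        by (induction rule: vec.span_induct_alt)
          (auto simp: br_left op_trace_zero op_trace_add op_trace_scale trace_ad_derivation[OF S])
      then show ?thesis by (rule tr)
    qed
  qed
  then have "br a b = 0" if "a \<in> ?N" for a b
    using that vec.span_base[of "br a b" ?G] by blast
  then have "?N = {0}" using abelian_ideal_trivial[OF N N_ideal] by blast
  with assms show ?thesis by blast
qed

lemma killing_represents:
  assumes \<phi>: "\<And>x y. \<phi> (x + y) = \<phi> x + \<phi> y" "\<And>c x. \<phi> (c *s x) = c * \<phi> x"
  shows "\<exists>d. \<forall>z. \<phi> z = killing d z"
proof -
  have expand: "\<psi> z = (\<Sum>i\<in>UNIV. z $ i * \<psi> (axis i 1))"
    if "\<And>x y. \<psi> (x + y) = \<psi> x + \<psi> y" "\<And>c x. \<psi> (c *s x) = c * \<psi> x"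
    for \<psi> :: "complex^'n \<Rightarrow> complex" and z
  proof -
    have "Vector_Spaces.linear (*s) (*) \<psi>"
      using that by (simp add: Vector_Spaces.linear_iff vec.vector_space_axioms
          vector_space_over_itself.vector_space_axioms)
    then interpret \<psi>: Vector_Spaces.linear "(*s)" "(*)" \<psi> .
    have "\<psi> z = \<psi> (\<Sum>i\<in>UNIV. z $ i *s axis i 1)" by (simp add: basis_expansion)
    then show ?thesis by (simp add: \<psi>.sum \<psi>.scale)
  qed
  \<comment> \<open>Nondegeneracy makes this map injective, and finite dimension makes it
    surjective.\<close>
  let ?J = "\<lambda>z. \<chi> i. killing z (axis i 1)"
  have lin: "clinear ?J" by (simp add: clinear_iff vec_eq_iff killing_left)
  have "z = 0" if "?J z = 0" for z
  proof (rule killing_nondegenerate)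
    show "killing z w = 0" for w
      using that expand[of "killing z" w] by (simp add: vec_eq_iff killing_right)
  qed
  then have "x - y = 0" if "?J x = ?J y" for x y
    using that clinearD(4)[OF lin, of x y] right_minus_eq[of "?J x" "?J y"] by metis
  then have "inj ?J" by (intro injI) (simp only: right_minus_eq)
  then have "surj ?J" by (rule vec.linear_inj_imp_surj[OF lin])
  then obtain d where "(\<chi> i. \<phi> (axis i 1)) = ?J d" by (rule surjE)
  then have "\<phi> (axis i 1) = killing d (axis i 1)" for i by (simp add: vec_eq_iff)
  then have "\<phi> z = killing d z" for z
    using expand[of \<phi> z] expand[of "killing d" z] \<phi> by (simp add: killing_right)
  then show ?thesis by blast
qed

text \<open>The trace of \<open>br z\<close> composed with \<open>\<delta>\<close> is linear in
  \<open>z\<close>, hence represented by some \<open>d\<close>. For the difference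
  \<open>?\<epsilon>\<close> all such traces vanish, and \<open>trace_ad_derivation\<close> makes
  its values orthogonal to everything.\<close>

lemma derivation_inner:
  assumes \<delta>: "derivation \<delta>"
  shows "\<exists>d. \<delta> = br d"
proof -
  have "\<exists>d. \<forall>z. op_trace (\<lambda>v. br z (\<delta> v)) = killing d z"
    by (rule killing_represents) (simp_all add: br_left op_trace_add op_trace_scale)
  then obtain d where d: "\<And>z. op_trace (\<lambda>v. br z (\<delta> v)) = killing d z" by blast
  let ?\<epsilon> = "\<lambda>v. \<delta> v - br d v"
  have \<epsilon>: "derivation ?\<epsilon>" by (rule derivation_diff[OF \<delta> derivation_ad])
  have "?\<epsilon> x = 0" for x
  proof (rule killing_nondegenerate)
    fix z
    have "op_trace (\<lambda>v. br w (?\<epsilon> v)) = 0" for w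
      using d[of w] by (simp add: br_right op_trace_diff killing_sym[of d] killing_def[of w])
    then have "killing z (?\<epsilon> x) = 0" using trace_ad_derivation[OF \<epsilon>, of z x] by simp
    then show "killing (?\<epsilon> x) z = 0" by (simp add: killing_sym)
  qed
  then have "\<delta> = br d" by auto
  then show ?thesis by blast
qed

text \<open>Some coordinate of \<open>w - P w\<close>, with \<open>P\<close> a projection onto
  \<open>R\<close>, is a nonzero functional vanishing on \<open>R\<close>.\<close>

lemma killing_orthogonal_exists:
  assumes R: "vec.subspace R" "R \<noteq> UNIV"
  shows "\<exists>z. z \<noteq> 0 \<and> (\<forall>r\<in>R. killing z r = 0)"
proof -
  obtain P where P: "clinear P" "\<And>v. P v \<in> R" "\<And>v. v \<in> R \<Longrightarrow> P v = v"
    using subspace_projection[OF R(1)] by metis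
  obtain v where "v \<notin> R" using R(2) by blast
  then have "v - P v \<noteq> 0" using P(2) by (metis right_minus_eq)
  then obtain i where i: "(v - P v) $ i \<noteq> 0" by (metis vec_eq_iff zero_index)
  have "\<exists>z. \<forall>w. (w - P w) $ i = killing z w"
    by (rule killing_represents) (auto simp: clinearD[OF P(1)] algebra_simps)
  then obtain z where z: "\<And>w. (w - P w) $ i = killing z w" by blast
  have "z \<noteq> 0" using i z[of v] by (auto simp: killing_left)
  moreover have "killing z r = 0" if "r \<in> R" for r using z[of r] P(3)[OF that] by simp
  ultimately show ?thesis by blast
qed

text \<open>By invariance an element orthogonal to all brackets is central, hence in the radical of
  the Killing form.\<close>

lemma perfect: "vec.span {br x y |x y. True} = UNIV"
proof (rule ccontr)
  assume "vec.span {br x y |x y. True} \<noteq> UNIV"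
  then obtain z where z: "z \<noteq> 0" "\<And>r. r \<in> vec.span {br x y |x y. True} \<Longrightarrow> killing z r = 0"
    using killing_orthogonal_exists[OF vec.subspace_span] by blast
  have "killing (br z x) y = 0" for x y
    unfolding killing_invariant by (rule z(2), rule vec.span_base) blast
  then have "br z x = 0" for x using killing_nondegenerate by blast
  then have "killing z y = 0" for y by (simp add: killing_def op_trace_zero)
  with z(1) killing_nondegenerate show False by blast
qed

text \<open>For \<open>x\<close> orthogonal to \<open>R\<close>, the conjugate derivation of
  \<open>br x\<close> is \<open>br d\<close> with \<open>d\<close> diagonalizable. Then
  \<open>d\<close> lies in \<open>R\<close>, the trace is \<open>killing x d = 0\<close>, and the
  nilpotency test applies.\<close>

lemma ideal_with_diagonalizables:
  assumes R: "vec.subspace R" "\<And>x y. x \<in> R \<Longrightarrow> br y x \<in> R"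
    and diag: "\<And>d B lam. vec.span B = UNIV \<Longrightarrow> (\<And>b. b \<in> B \<Longrightarrow> br d b = lam b *s b) \<Longrightarrow> d \<in> R"
  shows "R = UNIV"
proof (rule ccontr)
  assume "R \<noteq> UNIV"
  then obtain z where z: "z \<noteq> 0" "\<And>r. r \<in> R \<Longrightarrow> killing z r = 0"
    using killing_orthogonal_exists[OF R(1)] by blast
  let ?C = "{z. \<forall>r\<in>R. killing z r = 0}"
  have C: "vec.subspace ?C" by (auto simp: vec.subspace_def killing_left)
  have C_ideal: "br y x \<in> ?C" if "x \<in> ?C" for x y
    using that R(2) by (auto simp: br_anti[of y x] killing_minus killing_invariant)
  have nil: "ad_nilpotent x" if "x \<in> ?C" for x
  proof (rule ad_conjugate_derivation[of x])
    fix S B lam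
    assume S: "derivation S" and B: "vec.span B = UNIV" "\<And>b. b \<in> B \<Longrightarrow> S b = lam b *s b"
      and tr: "op_trace (\<lambda>v. br x (S v)) = 0 \<Longrightarrow> ad_nilpotent x"
    obtain d where d: "S = br d" using derivation_inner[OF S] by blast
    have "d \<in> R" using diag[OF B(1)] B(2) d by blast
    then have "op_trace (\<lambda>v. br x (S v)) = 0" using \<open>x \<in> ?C\<close> by (simp add: d killing_def)
    then show ?thesis by (rule tr)
  qed
  have "?C = {0}" by (rule nilpotent_ideal_trivial[OF C C_ideal nil])
  with z show False by blast
qed

end

section \<open>Polynomial vector fields\<close>

lemma cpoly_sum: "(\<And>a. a \<in> A \<Longrightarrow> f a \<in> cpoly) \<Longrightarrow> (\<lambda>p. \<Sum>a\<in>A. f a p) \<in> cpoly"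
proof (induction A rule: infinite_finite_induct)
  case (insert a A)
  then show ?case using cpoly.add[of "f a" "\<lambda>p. \<Sum>a\<in>A. f a p"] by simp
qed (auto intro: cpoly.const[of 0, simplified])

lemma cpoly_power: "f \<in> cpoly \<Longrightarrow> (\<lambda>p. f p ^ k) \<in> cpoly"
  by (induction k) (auto intro: cpoly.const cpoly.mult)

lemma cpoly_linear:
  assumes "\<And>x y. \<phi> (x + y) = \<phi> x + \<phi> y" "\<And>c x. \<phi> (c *s x) = c * \<phi> x"
  shows "\<phi> \<in> cpoly"
proof -
  have sum: "\<phi> (sum f A) = (\<Sum>a\<in>A. \<phi> (f a))" for f and A :: "'n set"
    by (induction A rule: infinite_finite_induct) (use assms(1) assms(2)[of 0] in auto)
  have "\<phi> p = (\<Sum>i\<in>UNIV. p $ i * \<phi> (axis i 1))" for p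
  proof -
    have "\<phi> p = \<phi> (\<Sum>i\<in>UNIV. p $ i *s axis i 1)" by (simp add: basis_expansion)
    then show ?thesis by (simp add: sum assms(2))
  qed
  then have eq: "\<phi> = (\<lambda>p. \<Sum>i\<in>UNIV. p $ i * \<phi> (axis i 1))" by (rule ext)
  have "(\<lambda>p. \<Sum>i\<in>UNIV. p $ i * \<phi> (axis i 1)) \<in> cpoly"
    by (intro cpoly_sum cpoly.mult cpoly.coord cpoly.const)
  then show ?thesis by (subst eq)
qed

lemma scaleR_eq_scale: "r *\<^sub>R x = of_real r *s (x :: complex^'n)"
  unfolding vec_eq_iff by (simp only: vector_scaleR_component vector_smult_component) (simp add: scaleR_conv_of_real)

lemma clinear_has_derivative:
  assumes "clinear A"
  shows "(A has_derivative A) (at p)"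
proof -
  have "linear A"
    by (rule linearI) (simp_all add: clinearD[OF assms] scaleR_eq_scale)
  then show ?thesis
    by (intro bounded_linear_imp_has_derivative) (simp add: linear_conv_bounded_linear)
qed

lemma bounded_bilinear_scale: "bounded_bilinear (\<lambda>c (x :: complex^'n). c *s x)"
proof
  show "\<exists>K. \<forall>a (b :: complex^'n). norm (a *s b) \<le> norm a * norm b * K"
    by (intro exI[of _ 1])
      (simp add: norm_vec_def norm_mult L2_set_right_distrib[symmetric])
qed (simp_all add: scaleR_eq_scale vec.scale_left_distrib vec.scale_right_distrib
    scaleR_conv_of_real mult.commute)

text \<open>A Frechet derivative is in general only real linear, so complex homogeneity is carried
  through the induction, together with polynomiality along linear fields.\<close>

lemma cpoly_derivative:
  fixes f :: "complex^'n \<Rightarrow> complex"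
  assumes "f \<in> cpoly"
  shows "\<exists>D. (\<forall>p. (f has_derivative D p) (at p)) \<and> (\<forall>p c v. D p (c *s v) = c * D p v) \<and>
    (\<forall>A. clinear A \<longrightarrow> (\<lambda>p. D p (A p)) \<in> cpoly)"
  using assms
proof induction
  case (const c)
  show ?case by (intro exI[of _ "\<lambda>p v. 0"]) (auto intro: cpoly.const)
next
  case (coord i)
  show ?case
  proof (intro exI[of _ "\<lambda>p v. v $ i"] conjI allI impI)
    show "((\<lambda>p. p $ i) has_derivative (\<lambda>v. v $ i)) (at p)" for p :: "complex^'n"
      by (rule bounded_linear_imp_has_derivative[OF bounded_linear_vec_nth])
    show "(\<lambda>p. A p $ i) \<in> cpoly" if "clinear A" for A :: "complex^'n \<Rightarrow> complex^'n"
      by (rule cpoly_linear) (simp_all add: clinearD[OF that])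
  qed simp
next
  case (add f g)
  then obtain D E where
    D: "\<And>p. (f has_derivative D p) (at p)" "\<And>p c v. D p (c *s v) = c * D p v"
      "\<And>A. clinear A \<Longrightarrow> (\<lambda>p. D p (A p)) \<in> cpoly" and
    E: "\<And>p. (g has_derivative E p) (at p)" "\<And>p c v. E p (c *s v) = c * E p v"
      "\<And>A. clinear A \<Longrightarrow> (\<lambda>p. E p (A p)) \<in> cpoly" by blast
  show ?case
  proof (intro exI[of _ "\<lambda>p v. D p v + E p v"] conjI allI impI)
    show "((\<lambda>p. f p + g p) has_derivative (\<lambda>v. D p v + E p v)) (at p)" for p
      using D(1) E(1) by (rule has_derivative_add)
    show "(\<lambda>p. D p (A p) + E p (A p)) \<in> cpoly" if "clinear A" for A
      using D(3)[OF that] E(3)[OF that] by (rule cpoly.add)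
  qed (simp add: D(2) E(2) distrib_left)
next
  case (mult f g)
  then obtain D E where
    D: "\<And>p. (f has_derivative D p) (at p)" "\<And>p c v. D p (c *s v) = c * D p v"
      "\<And>A. clinear A \<Longrightarrow> (\<lambda>p. D p (A p)) \<in> cpoly" and
    E: "\<And>p. (g has_derivative E p) (at p)" "\<And>p c v. E p (c *s v) = c * E p v"
      "\<And>A. clinear A \<Longrightarrow> (\<lambda>p. E p (A p)) \<in> cpoly" by blast
  show ?case
  proof (intro exI[of _ "\<lambda>p v. f p * E p v + D p v * g p"] conjI allI impI)
    show "((\<lambda>p. f p * g p) has_derivative (\<lambda>v. f p * E p v + D p v * g p)) (at p)" for p
      using D(1) E(1) by (rule has_derivative_mult)
    show "(\<lambda>p. f p * E p (A p) + D p (A p) * g p) \<in> cpoly" if "clinear A" for A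
      using cpoly.add[OF cpoly.mult[OF mult.hyps(1) E(3)[OF that]] cpoly.mult[OF D(3)[OF that] mult.hyps(2)]] .
  qed (simp add: D(2) E(2) algebra_simps)
qed

lemma vf_apply_eq: "(h has_derivative D) (at p) \<Longrightarrow> vf_apply X h p = D (X p)"
  unfolding vf_apply_def by (simp add: frechet_derivative_at[symmetric])

lemma cpoly_has_derivative:
  assumes "f \<in> cpoly"
  shows "(f has_derivative (\<lambda>v. vf_apply (\<lambda>_. v) f p)) (at p)"
proof -
  obtain D where D: "(f has_derivative D p) (at p)" using cpoly_derivative[OF assms] by blast
  then have "(\<lambda>v. vf_apply (\<lambda>_. v) f p) = D p" by (simp add: vf_apply_eq)
  with D show ?thesis by simp
qed

lemma vf_apply_scale:
  assumes "f \<in> cpoly"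
  shows "vf_apply (\<lambda>q. g q *s X q) f p = g p * vf_apply X f p"
proof -
  obtain D where "(f has_derivative D p) (at p)" "\<And>c v. D p (c *s v) = c * D p v"
    using cpoly_derivative[OF assms] by blast
  then show ?thesis by (simp add: vf_apply_eq)
qed

lemma cpoly_vf_apply:
  assumes "f \<in> cpoly" "clinear A"
  shows "vf_apply A f \<in> cpoly"
proof -
  obtain D where D: "\<And>p. (f has_derivative D p) (at p)" "(\<lambda>p. D p (A p)) \<in> cpoly"
    using cpoly_derivative[OF assms(1)] assms(2) by blast
  then have "vf_apply A f = (\<lambda>p. D p (A p))" by (auto simp: vf_apply_eq)
  with D(2) show ?thesis by simp
qed

lemma vf_bracket_add_left:
  assumes "\<And>p. X differentiable (at p)" "\<And>p. X' differentiable (at p)" "\<And>p. Y differentiable (at p)"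
  shows "vf_bracket (\<lambda>p. X p + X' p) Y = (\<lambda>p. vf_bracket X Y p + vf_bracket X' Y p)"
proof
  fix p
  obtain DX DX' DY where D: "(X has_derivative DX) (at p)" "(X' has_derivative DX') (at p)"
    "(Y has_derivative DY) (at p)" using assms by (meson differentiable_def)
  have "DY (X p + X' p) = DY (X p) + DY (X' p)"
    using has_derivative_linear[OF D(3)] by (rule linear_add)
  then show "vf_bracket (\<lambda>p. X p + X' p) Y p = vf_bracket X Y p + vf_bracket X' Y p"
    by (simp add: vf_bracket_def vf_apply_eq[OF D(1)] vf_apply_eq[OF D(2)] vf_apply_eq[OF D(3)]
        vf_apply_eq[OF has_derivative_add[OF D(1,2)]])
qed

lemma vf_bracket_anti: "vf_bracket X Y = (\<lambda>p. - vf_bracket Y X p)"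
  by (simp add: vf_bracket_def)

section \<open>Brackets of polynomial multiples of linear fields\<close>

context lie_alg
begin

definition field :: "(complex^'n \<Rightarrow> complex) \<Rightarrow> complex^'n \<Rightarrow> complex^'n \<Rightarrow> complex^'n" where
  "field f \<xi> = (\<lambda>p. f p *s br \<xi> p)"

lemma field_has_derivative:
  assumes "f \<in> cpoly"
  shows "(field f \<xi> has_derivative (\<lambda>v. f p *s br \<xi> v + vf_apply (\<lambda>_. v) f p *s br \<xi> p)) (at p)"
  unfolding field_def
  using bounded_bilinear.FDERIV[OF bounded_bilinear_scale cpoly_has_derivative[OF assms]
      clinear_has_derivative[OF clinear_ad]] .

text \<open>The last sign is negative because passing from \<open>\<xi>\<close> to its linear field
  reverses brackets under the convention \<open>[X, Y] h = X (Y h) - Y (X h)\<close>.\<close>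

lemma vf_bracket_field:
  assumes "f \<in> cpoly" "g \<in> cpoly"
  shows "vf_bracket (field f \<xi>) (field g \<eta>) = (\<lambda>p. (f p * vf_apply (br \<xi>) g p) *s br \<eta> p
    - (g p * vf_apply (br \<eta>) f p) *s br \<xi> p - (f p * g p) *s br (br \<xi> \<eta>) p)"
proof
  fix p :: "complex^'n"
  have scale: "vf_apply (\<lambda>_. c *s w) h p = c * vf_apply X h p" if "h \<in> cpoly" "X p = w" for c w h X
    using vf_apply_scale[OF that(1), of "\<lambda>_. c" X p] that(2) by (simp add: vf_apply_def)
  show "vf_bracket (field f \<xi>) (field g \<eta>) p = (f p * vf_apply (br \<xi>) g p) *s br \<eta> p
    - (g p * vf_apply (br \<eta>) f p) *s br \<xi> p - (f p * g p) *s br (br \<xi> \<eta>) p"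
    unfolding vf_bracket_def vf_apply_eq[OF field_has_derivative[OF assms(1)]]
      vf_apply_eq[OF field_has_derivative[OF assms(2)]]
    using scale[OF assms(1), of "br \<eta>"] scale[OF assms(2), of "br \<xi>"]
    by (simp add: field_def br_right jacobi vec.scale_right_diff_distrib mult.commute algebra_simps)
qed

lemma field_in_poly_fields: "f \<in> cpoly \<Longrightarrow> field f \<xi> \<in> poly_fields br"
  unfolding poly_fields_def field_def lin_vf_def by (auto intro!: exI[of _ "[(f, \<xi>)]"])

lemma zero_in_poly_fields: "(\<lambda>p. 0) \<in> poly_fields br"
  unfolding poly_fields_def by (auto intro!: exI[of _ "[]"])

lemma add_in_poly_fields:
  assumes "X \<in> poly_fields br" "Y \<in> poly_fields br"
  shows "(\<lambda>p. X p + Y p) \<in> poly_fields br"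
proof -
  obtain fs gs where "\<forall>(f, \<xi>) \<in> set fs. f \<in> cpoly" "\<forall>(f, \<xi>) \<in> set gs. f \<in> cpoly"
    "X = (\<lambda>p. sum_list (map (\<lambda>(f, \<xi>). f p *s lin_vf br \<xi> p) fs))"
    "Y = (\<lambda>p. sum_list (map (\<lambda>(f, \<xi>). f p *s lin_vf br \<xi> p) gs))"
    using assms unfolding poly_fields_def by blast
  then show ?thesis unfolding poly_fields_def by (auto intro!: exI[of _ "fs @ gs"])
qed

lemma poly_fields_induct [consumes 1, case_names zero add]:
  assumes "X \<in> poly_fields br" and "P (\<lambda>p. 0)"
    and step: "\<And>f \<xi> X. f \<in> cpoly \<Longrightarrow> X \<in> poly_fields br \<Longrightarrow> P X \<Longrightarrow> P (\<lambda>p. field f \<xi> p + X p)"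
  shows "P X"
proof -
  obtain fs where "\<forall>(f, \<xi>) \<in> set fs. f \<in> cpoly"
    "X = (\<lambda>p. sum_list (map (\<lambda>(f, \<xi>). f p *s lin_vf br \<xi> p) fs))"
    using assms(1) unfolding poly_fields_def by blast
  then show ?thesis
  proof (induction fs arbitrary: X)
    case Nil
    then show ?case using assms(2) by simp
  next
    case (Cons a fs)
    obtain f \<xi> where a: "a = (f, \<xi>)" by (cases a)
    let ?Y = "\<lambda>p. sum_list (map (\<lambda>(f, \<xi>). f p *s lin_vf br \<xi> p) fs)"
    have "?Y \<in> poly_fields br" using Cons.prems(1) unfolding poly_fields_def by auto
    moreover have "P ?Y" using Cons by auto
    ultimately have "P (\<lambda>p. field f \<xi> p + ?Y p)" using Cons.prems(1) a by (intro step) auto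
    then show ?case by (simp add: Cons.prems(2) a field_def lin_vf_def)
  qed
qed

lemma scale_in_poly_fields: "X \<in> poly_fields br \<Longrightarrow> (\<lambda>p. c *s X p) \<in> poly_fields br"
proof (induction rule: poly_fields_induct)
  case zero
  then show ?case by (simp add: zero_in_poly_fields)
next
  case (add f \<xi> X)
  have "field (\<lambda>p. c * f p) \<xi> \<in> poly_fields br"
    using add.hyps(1) by (intro field_in_poly_fields cpoly.mult cpoly.const)
  from add_in_poly_fields[OF this add.IH] show ?case
    by (simp add: field_def vec.scale_right_distrib)
qed

lemma poly_fields_differentiable: "X \<in> poly_fields br \<Longrightarrow> X differentiable (at p)"
proof (induction rule: poly_fields_induct)
  case (add f \<xi> X)
  then show ?case
    using field_has_derivative[OF add.hyps(1), of \<xi> p] differentiable_add differentiable_def by blast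
qed simp

lemma bracket_field_in_poly_fields:
  assumes "f \<in> cpoly" "g \<in> cpoly"
  shows "vf_bracket (field f \<xi>) (field g \<eta>) \<in> poly_fields br"
proof -
  have D: "vf_apply (br \<xi>) g \<in> cpoly" "vf_apply (br \<eta>) f \<in> cpoly"
    using assms cpoly_vf_apply clinear_ad by blast+
  have neg: "(\<lambda>p. - 1 * (h p * k p)) \<in> cpoly" if "h \<in> cpoly" "k \<in> cpoly" for h k :: "complex^'n \<Rightarrow> complex"
    using cpoly.mult[OF cpoly.const cpoly.mult[OF that]] .
  have "(\<lambda>p. (field (\<lambda>p. f p * vf_apply (br \<xi>) g p) \<eta> p
      + field (\<lambda>p. - 1 * (g p * vf_apply (br \<eta>) f p)) \<xi> p)
      + field (\<lambda>p. - 1 * (f p * g p)) (br \<xi> \<eta>) p) \<in> poly_fields br"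
    by (rule add_in_poly_fields[OF add_in_poly_fields[OF
          field_in_poly_fields[OF cpoly.mult[OF assms(1) D(1)]]
          field_in_poly_fields[OF neg[OF assms(2) D(2)]]]
          field_in_poly_fields[OF neg[OF assms]]])
  then show ?thesis unfolding vf_bracket_field[OF assms] by (simp add: field_def)
qed

text \<open>Left additivity is used once for each argument, with antisymmetry in between.\<close>

lemma bracket_in_poly_fields:
  assumes "X \<in> poly_fields br" "Y \<in> poly_fields br"
  shows "vf_bracket X Y \<in> poly_fields br"
proof -
  have bracket_0: "vf_bracket (\<lambda>p. 0) Y = (\<lambda>p. 0)" if Y: "Y \<in> poly_fields br" for Y
  proof
    fix p
    obtain D where D: "(Y has_derivative D) (at p)"
      using poly_fields_differentiable[OF Y, of p] unfolding differentiable_def by blast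
    have "D 0 = 0" using has_derivative_linear[OF D] by (rule linear_0)
    then show "vf_bracket (\<lambda>p. 0) Y p = 0"
      by (simp add: vf_bracket_def vf_apply_eq[OF D] vf_apply_eq[OF has_derivative_const])
  qed
  have anti: "vf_bracket Y X \<in> poly_fields br" if "vf_bracket X Y \<in> poly_fields br" for X Y
    using scale_in_poly_fields[OF that, of "- 1"] vf_bracket_anti[of Y X] by simp
  have field: "vf_bracket Y (field f \<xi>) \<in> poly_fields br" if f: "f \<in> cpoly" and Y: "Y \<in> poly_fields br" for f \<xi> Y
    using Y
  proof (induction rule: poly_fields_induct)
    case zero
    then show ?case using f by (simp add: bracket_0 field_in_poly_fields zero_in_poly_fields)
  next
    case (add g \<eta> Y)
    have "vf_bracket (\<lambda>p. field g \<eta> p + Y p) (field f \<xi>)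
        = (\<lambda>p. vf_bracket (field g \<eta>) (field f \<xi>) p + vf_bracket Y (field f \<xi>) p)"
      using add.hyps f by (intro vf_bracket_add_left poly_fields_differentiable field_in_poly_fields)
    then show ?case
      using add bracket_field_in_poly_fields[OF add.hyps(1) f] by (simp add: add_in_poly_fields)
  qed
  show ?thesis
    using assms(1)
  proof (induction rule: poly_fields_induct)
    case zero
    then show ?case using assms(2) by (simp add: bracket_0 zero_in_poly_fields)
  next
    case (add f \<xi> X)
    have "vf_bracket (\<lambda>p. field f \<xi> p + X p) Y
        = (\<lambda>p. vf_bracket (field f \<xi>) Y p + vf_bracket X Y p)"
      using add.hyps assms(2) by (intro vf_bracket_add_left poly_fields_differentiable field_in_poly_fields)
    then show ?case
      using add.IH anti[OF field[OF add.hyps(1) assms(2)]] by (simp add: add_in_poly_fields)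
  qed
qed

lemma lie_generated_subset: "lie_generated (overshears br) \<subseteq> poly_fields br"
proof
  fix X assume "X \<in> lie_generated (overshears br)"
  then show "X \<in> poly_fields br"
  proof induction
    case (base X)
    then obtain f \<xi> where "f \<in> cpoly" "X = field f \<xi>"
      unfolding overshears_def field_def lin_vf_def by (elim CollectE exE conjE)
    then show ?case by (simp add: field_in_poly_fields)
  qed (simp_all add: zero_in_poly_fields add_in_poly_fields scale_in_poly_fields bracket_in_poly_fields)
qed

end

section \<open>Generation by overshears\<close>

text \<open>If \<open>F t\<close> is the sum of top degree \<open>n + 1\<close>, then
  \<open>F (2 * t) - 2 ^ (n + 1) * F t\<close> loses its top term and rescales the others by the
  nonzero \<open>2 ^ i - 2 ^ (n + 1)\<close>. Induction recovers these lower coefficients, and the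
  top one is the value at \<open>1\<close> minus their sum.\<close>

lemma coefficients_mem:
  fixes S :: "('a \<Rightarrow> complex^'n) set"
  assumes add: "\<And>X Y. X \<in> S \<Longrightarrow> Y \<in> S \<Longrightarrow> (\<lambda>p. X p + Y p) \<in> S"
    and smult: "\<And>c X. X \<in> S \<Longrightarrow> (\<lambda>p. c *s X p) \<in> S"
    and mem: "\<And>t. (\<lambda>p. \<Sum>i\<le>n. t ^ i *s v i p) \<in> S" and "j \<le> n"
  shows "v j \<in> S"
  using mem \<open>j \<le> n\<close>
proof (induction n arbitrary: v j)
  case 0
  from "0.prems"(1)[of 1] "0.prems"(2) show ?case by simp
next
  case (Suc n)
  let ?F = "\<lambda>t p. \<Sum>i\<le>Suc n. t ^ i *s v i p"
  let ?c = "\<lambda>i. 2 ^ i - 2 ^ Suc n :: complex"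
  have c: "?c i \<noteq> 0" if "i \<le> n" for i
  proof -
    have "(2::nat) ^ i < 2 ^ Suc n" using that by (intro power_strict_increasing) auto
    then have "(of_nat (2 ^ i) :: complex) \<noteq> of_nat (2 ^ Suc n)" by (metis of_nat_eq_iff less_irrefl)
    then show ?thesis by simp
  qed
  have low: "v i \<in> S" if "i \<le> n" for i
  proof -
    have "(\<lambda>p. \<Sum>i\<le>n. t ^ i *s (?c i *s v i p)) \<in> S" for t
    proof -
      have "(\<lambda>p. ?F (2 * t) p + (- (2 ^ Suc n)) *s ?F t p) \<in> S"
        using Suc.prems(1) by (intro add smult)
      moreover have "?F (2 * t) p + (- (2 ^ Suc n)) *s ?F t p = (\<Sum>i\<le>n. t ^ i *s (?c i *s v i p))" for p
      proof -
        have "?F (2 * t) p + (- (2 ^ Suc n)) *s ?F t p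
            = (\<Sum>i\<le>Suc n. (2 * t) ^ i *s v i p + (- (2 ^ Suc n)) *s (t ^ i *s v i p))"
          by (simp only: vec.scale_sum_right sum.distrib)
        also have "\<dots> = (\<Sum>i\<le>Suc n. t ^ i *s (?c i *s v i p))"
          by (intro sum.cong refl, simp only: vec.scale_scale vec.scale_left_distrib[symmetric])
            (simp add: power_mult_distrib algebra_simps)
        also have "\<dots> = (\<Sum>i\<le>n. t ^ i *s (?c i *s v i p))" by simp
        finally show ?thesis .
      qed
      ultimately show ?thesis by simp
    qed
    from Suc.IH[OF this that] have "(\<lambda>p. ?c i *s v i p) \<in> S" .
    from smult[OF this, of "inverse (?c i)"] show ?thesis
      using c[OF that] by (simp only: vec.scale_scale left_inverse) simp
  qed
  have zero: "(\<lambda>p. 0) \<in> S" using smult[OF Suc.prems(1), of 0 0] by simp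
  have "(\<lambda>p. \<Sum>i\<in>A. v i p) \<in> S" if "finite A" "A \<subseteq> {..n}" for A
    using that
  proof (induction A rule: finite_induct)
    case (insert a A)
    then show ?case using add[OF low[of a], of "\<lambda>p. \<Sum>i\<in>A. v i p"] by simp
  qed (simp add: zero)
  then have "(\<lambda>p. \<Sum>i\<le>n. v i p) \<in> S" by simp
  from add[OF Suc.prems(1)[of 1] smult[OF this, of "- 1"]]
  have "v (Suc n) \<in> S" by simp
  with low Suc.prems(2) show ?case by (auto simp: le_Suc_eq)
qed

text \<open>This is the coefficient of \<open>t\<close> in the given family: its derivative at
  \<open>t = 0\<close>, obtained algebraically.\<close>

lemma linear_coefficient_mem:
  fixes S :: "('a \<Rightarrow> complex^'n) set"
  assumes add: "\<And>X Y. X \<in> S \<Longrightarrow> Y \<in> S \<Longrightarrow> (\<lambda>p. X p + Y p) \<in> S"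
    and smult: "\<And>c X. X \<in> S \<Longrightarrow> (\<lambda>p. c *s X p) \<in> S"
    and mem: "\<And>t. (\<lambda>p. (f p + t * g p) ^ k *s (A p + t *s B p)) \<in> S"
  shows "(\<lambda>p. (of_nat k * f p ^ (k - 1) * g p) *s A p + f p ^ k *s B p) \<in> S"
proof -
  define u where "u i p = of_nat (k choose i) * (g p ^ i * f p ^ (k - i))" for i p
  \<comment> \<open>The factor \<open>t\<close> in front of \<open>B\<close> shifts its coefficients
    by one, so the total degree is \<open>k + 1\<close> and index 0 gets no share of
    \<open>B\<close>.\<close>
  define v where "v i p = u i p *s A p + (if i = 0 then 0 else u (i - 1) p *s B p)" for i p
  have poly: "(\<lambda>p. \<Sum>i\<le>Suc k. t ^ i *s v i p) \<in> S" for t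
  proof -
    have "(f p + t * g p) ^ k *s (A p + t *s B p) = (\<Sum>i\<le>Suc k. t ^ i *s v i p)" for p
    proof -
      have bin: "(f p + t * g p) ^ k = (\<Sum>i\<le>k. t ^ i * u i p)"
        unfolding add.commute[of "f p"] binomial_ring u_def
        by (simp add: power_mult_distrib algebra_simps)
      have "u (Suc k) p = 0" by (simp add: u_def)
      then have "(\<Sum>i\<le>Suc k. t ^ i *s (u i p *s A p)) = (f p + t * g p) ^ k *s A p"
        unfolding bin vec.scale_sum_left by simp
      moreover have "(\<Sum>i\<le>Suc k. t ^ i *s (if i = 0 then 0 else u (i - 1) p *s B p))
          = (f p + t * g p) ^ k *s (t *s B p)"
        unfolding bin vec.scale_sum_left sum.atMost_Suc_shift by (simp add: mult.assoc mult.left_commute mult.commute)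
      ultimately show ?thesis
        by (simp only: v_def vec.scale_right_distrib sum.distrib)
    qed
    then show ?thesis using mem[of t] by simp
  qed
  have "v 1 \<in> S" by (rule coefficients_mem[OF add smult poly]) auto
  moreover have "v 1 = (\<lambda>p. (of_nat k * f p ^ (k - 1) * g p) *s A p + f p ^ k *s B p)"
    by (auto simp: v_def u_def mult.commute mult.left_commute)
  ultimately show ?thesis by simp
qed

section \<open>Overshears built from the Killing form\<close>

context lie_alg
begin

lemma killing_cpoly: "killing x \<in> cpoly"
  by (rule cpoly_linear) (simp_all add: killing_right)

lemma vf_apply_killing_power:
  "vf_apply (br \<xi>) (\<lambda>p. c * killing x p ^ k) p
    = c * of_nat k * killing x p ^ (k - 1) * killing (br x \<xi>) p"
proof -
  have "linear (killing x)"
    by (rule linearI) (simp_all add: killing_right scaleR_eq_scale scaleR_conv_of_real)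
  then have "(killing x has_derivative killing x) (at p)"
    by (intro bounded_linear_imp_has_derivative) (simp add: linear_conv_bounded_linear)
  then have "((\<lambda>p. c * killing x p ^ k) has_derivative
      (\<lambda>v. c * (of_nat k * killing x v * killing x p ^ (k - 1)))) (at p)"
    by (intro has_derivative_mult_right has_derivative_power)
  from vf_apply_eq[OF this] show ?thesis by (simp add: killing_invariant mult.commute mult.left_commute)
qed

lemma vf_apply_killing: "vf_apply (br \<xi>) (killing x) = killing (br x \<xi>)"
  using vf_apply_killing_power[of \<xi> 1 x 1] by auto

abbreviation overshear_algebra :: "(complex^'n \<Rightarrow> complex^'n) set" where
  "overshear_algebra \<equiv> lie_generated (overshears br)"

lemma overshearI:
  assumes "f \<in> cpoly" "\<And>p. vf_apply (br \<xi>) (vf_apply (br \<xi>) f) p = 0"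
  shows "field f \<xi> \<in> overshear_algebra"
proof (rule lie_generated.base)
  have "vf_apply (lin_vf br \<xi>) (vf_apply (lin_vf br \<xi>) f) = (\<lambda>p. 0)"
    using assms(2) by (auto simp: lin_vf_def)
  then show "field f \<xi> \<in> overshears br"
    unfolding overshears_def field_def using assms(1)
    by (intro CollectI exI[of _ f] exI[of _ \<xi>]) (simp add: lin_vf_def)
qed

lemma vf_apply_zero: "vf_apply X (\<lambda>p. 0) p = 0"
  by (simp add: vf_apply_eq[OF has_derivative_const])

text \<open>For the Killing form the linear function dual to \<open>x\<close> is annihilated by the vector field of
  \<open>x\<close>; this is special to the adjoint representation.\<close>
lemma killing_power_overshear: "field (\<lambda>p. killing x p ^ k) x \<in> overshear_algebra"
proof (rule overshearI)
  have "vf_apply (br x) (\<lambda>p. killing x p ^ k) = (\<lambda>p. 0)"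
    using vf_apply_killing_power[of x 1 x k] by (auto simp: br_self killing_left)
  then show "vf_apply (br x) (vf_apply (br x) (\<lambda>p. killing x p ^ k)) p = 0" for p
    by (simp add: vf_apply_zero)
qed (intro cpoly_power killing_cpoly)

lemma const_overshear: "field (\<lambda>p. 1) \<xi> \<in> overshear_algebra"
proof (rule overshearI[OF cpoly.const])
  have "vf_apply (br \<xi>) (\<lambda>p. 1 :: complex) = (\<lambda>p. 0)"
    by (auto simp: vf_apply_eq[OF has_derivative_const])
  then show "vf_apply (br \<xi>) (vf_apply (br \<xi>) (\<lambda>p. 1 :: complex)) p = 0" for p
    by (simp add: vf_apply_zero)
qed

text \<open>Along \<open>b\<close> the function \<open>killing d\<close> has derivative
  \<open>c * killing b\<close>, which \<open>b\<close> annihilates because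
  \<open>br b b = 0\<close>.\<close>

lemma eigenvector_overshear:
  assumes "br d b = c *s b"
  shows "field (killing d) b \<in> overshear_algebra"
proof (rule overshearI)
  have "vf_apply (br b) (killing d) = (\<lambda>p. c * killing b p ^ 1)"
    by (auto simp: vf_apply_killing assms killing_left)
  then show "vf_apply (br b) (vf_apply (br b) (killing d)) p = 0" for p
    by (simp only: vf_apply_killing_power br_self killing_left mult_zero_right)
qed (rule killing_cpoly)

lemma add_overshear_algebra:
  "X \<in> overshear_algebra \<Longrightarrow> Y \<in> overshear_algebra \<Longrightarrow> (\<lambda>p. X p + Y p) \<in> overshear_algebra"
  by (rule lie_generated.add)

lemma scale_overshear_algebra:
  "X \<in> overshear_algebra \<Longrightarrow> (\<lambda>p. c *s X p) \<in> overshear_algebra"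
  by (rule lie_generated.smult)

lemma diff_overshear_algebra:
  "X \<in> overshear_algebra \<Longrightarrow> Y \<in> overshear_algebra \<Longrightarrow> (\<lambda>p. X p - Y p) \<in> overshear_algebra"
  using add_overshear_algebra[of X "\<lambda>p. (- 1) *s Y p"] scale_overshear_algebra[of Y "- 1"] by simp

lemma polarize:
  assumes "\<And>t. (\<lambda>p. (f p + t * g p) ^ Suc k *s (A p + t *s B p)) \<in> overshear_algebra"
  shows "(\<lambda>p. (of_nat (Suc k) * f p ^ k * g p) *s A p + f p ^ Suc k *s B p) \<in> overshear_algebra"
proof -
  have "(\<lambda>p. (of_nat (Suc k) * f p ^ (Suc k - 1) * g p) *s A p + f p ^ Suc k *s B p)
      \<in> overshear_algebra"
    by (rule linear_coefficient_mem)
      (rule add_overshear_algebra scale_overshear_algebra assms; assumption)+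
  then show ?thesis by (simp only: diff_Suc_1)
qed

lemma subspace_field_direction: "vec.subspace {\<xi>. field f \<xi> \<in> overshear_algebra}"
  unfolding vec.subspace_def
proof (intro conjI ballI allI CollectI)
  show "field f 0 \<in> overshear_algebra"
    using lie_generated.zero by (simp add: field_def br_left)
  show "field f (\<xi> + \<eta>) \<in> overshear_algebra"
    if "\<xi> \<in> {\<xi>. field f \<xi> \<in> overshear_algebra}" "\<eta> \<in> {\<xi>. field f \<xi> \<in> overshear_algebra}" for \<xi> \<eta>
    using add_overshear_algebra[of "field f \<xi>" "field f \<eta>"] that
    by (simp add: field_def br_left vec.scale_right_distrib)
  show "field f (c *s \<xi>) \<in> overshear_algebra" if "\<xi> \<in> {\<xi>. field f \<xi> \<in> overshear_algebra}" for c \<xi>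
    using scale_overshear_algebra[of "field f \<xi>" c] that
    by (simp add: field_def br_left mult.commute)
qed

lemma field_spanning_directions:
  assumes "vec.span B = UNIV" "\<And>b. b \<in> B \<Longrightarrow> field f b \<in> overshear_algebra"
  shows "field f \<xi> \<in> overshear_algebra"
proof -
  have "vec.span B \<subseteq> {\<xi>. field f \<xi> \<in> overshear_algebra}"
    using assms(2) by (intro vec.span_minimal subspace_field_direction) auto
  with assms(1) show ?thesis by blast
qed

end

section \<open>Generation of fields of every degree\<close>

context semisimple_lie_alg
begin

lemma linear_field_in_overshear_algebra: "field (killing x) \<xi> \<in> overshear_algebra"
proof -
  let ?R = "{x. \<forall>\<xi>. field (killing x) \<xi> \<in> overshear_algebra}"
  have "?R = UNIV"
  proof (rule ideal_with_diagonalizables)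
    show "vec.subspace ?R"
      unfolding vec.subspace_def
    proof (intro conjI ballI allI CollectI)
      show "field (killing 0) \<xi> \<in> overshear_algebra" for \<xi>
        using lie_generated.zero by (simp add: field_def killing_left)
      show "field (killing (x + y)) \<xi> \<in> overshear_algebra" if "x \<in> ?R" "y \<in> ?R" for x y \<xi>
        using add_overshear_algebra[of "field (killing x) \<xi>" "field (killing y) \<xi>"] that
        by (simp add: field_def killing_left vec.scale_left_distrib)
      show "field (killing (c *s x)) \<xi> \<in> overshear_algebra" if "x \<in> ?R" for c x \<xi>
        using scale_overshear_algebra[of "field (killing x) \<xi>" c] that
        by (simp add: field_def killing_left)
    qed
    show "br y x \<in> ?R" if x: "x \<in> ?R" for x y
    proof (intro CollectI allI)
      fix \<xi>
      \<comment> \<open>One term of this bracket keeps the linear function of \<open>x\<close> and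
        only changes the direction, so it is already available; removing it leaves the function of
        \<open>br x y\<close>.\<close>
      have "vf_bracket (field (\<lambda>p. 1) y) (field (killing x) \<xi>) \<in> overshear_algebra"
        using const_overshear x by (intro lie_generated.bracket) auto
      moreover have "vf_bracket (field (\<lambda>p. 1) y) (field (killing x) \<xi>)
          = (\<lambda>p. killing (br x y) p *s br \<xi> p - killing x p *s br (br y \<xi>) p)"
        unfolding vf_bracket_field[OF cpoly.const killing_cpoly]
        by (simp add: vf_apply_killing vf_apply_eq[OF has_derivative_const])
      ultimately have "(\<lambda>p. killing (br x y) p *s br \<xi> p - killing x p *s br (br y \<xi>) p)
          \<in> overshear_algebra" by simp
      moreover have "field (killing x) (br y \<xi>) \<in> overshear_algebra" using x by blast
      ultimately have "(\<lambda>p. killing (br x y) p *s br \<xi> p) \<in> overshear_algebra"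
        using add_overshear_algebra by (fastforce simp: field_def)
      from scale_overshear_algebra[OF this, of "- 1"]
      show "field (killing (br y x)) \<xi> \<in> overshear_algebra"
        by (simp add: field_def br_anti[of y x] killing_minus)
    qed
    show "d \<in> ?R" if "vec.span B = UNIV" "\<And>b. b \<in> B \<Longrightarrow> br d b = lam b *s b" for d B lam
      using field_spanning_directions[OF that(1)] eigenvector_overshear that(2) by blast
  qed
  then show ?thesis by blast
qed

text \<open>Polarizing \<open>x\<^sup>k \<otimes> x\<close> and
  bracketing \<open>f \<otimes> x\<close> with \<open>x\<^bsup>k-1\<^esup> \<otimes> z\<close> gives two relations, which for \<open>k \<ge> 2\<close> together yield
  \<open>x\<^sup>k \<otimes> [z, x]\<close>; polarizing that and combining again yields \<open>x\<^sup>k \<otimes> [z, f]\<close>.\<close>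
lemma power_field_in_overshear_algebra: "field (\<lambda>p. killing x p ^ k) \<xi> \<in> overshear_algebra"
proof (induction k arbitrary: x \<xi>)
  case 0
  then show ?case using const_overshear by simp
next
  case (Suc m)
  show ?case
  proof (cases "m = 0")
    case True
    then show ?thesis using linear_field_in_overshear_algebra by simp
  next
    case False
    let ?k = "Suc m"
    let ?L = "overshear_algebra"
    let ?\<kappa> = "killing"
    \<comment> \<open>The function of \<open>x\<close> is annihilated along \<open>x\<close>, so the
      bracket has two terms instead of three.\<close>
    have bracket: "(\<lambda>p. (?\<kappa> x p ^ m * ?\<kappa> (br f z) p) *s br x p
        + (?\<kappa> f p * ?\<kappa> x p ^ m) *s br (br x z) p) \<in> ?L" for x f z
    proof -
      have "vf_bracket (field (?\<kappa> f) x) (field (\<lambda>p. ?\<kappa> x p ^ m) z) \<in> ?L"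
        using linear_field_in_overshear_algebra Suc.IH by (intro lie_generated.bracket)
      moreover have "vf_apply (br x) (\<lambda>p. ?\<kappa> x p ^ m) p = 0" for p
        using vf_apply_killing_power[of x 1 x m p] by (simp add: br_self killing_left)
      then have "vf_bracket (field (?\<kappa> f) x) (field (\<lambda>p. ?\<kappa> x p ^ m) z)
          = (\<lambda>p. - ((?\<kappa> x p ^ m * ?\<kappa> (br f z) p) *s br x p + (?\<kappa> f p * ?\<kappa> x p ^ m) *s br (br x z) p))"
        unfolding vf_bracket_field[OF killing_cpoly cpoly_power[OF killing_cpoly]]
        by (simp add: vf_apply_killing)
      ultimately show ?thesis
        using scale_overshear_algebra[of "vf_bracket (field (?\<kappa> f) x) (field (\<lambda>p. ?\<kappa> x p ^ m) z)" "- 1"]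
        by simp
    qed
    have polar: "(\<lambda>p. (of_nat ?k * ?\<kappa> x p ^ m * ?\<kappa> f p) *s br x p + ?\<kappa> x p ^ ?k *s br f p) \<in> ?L" for x f
    proof -
      have "(\<lambda>p. (?\<kappa> x p + t * ?\<kappa> f p) ^ ?k *s (br x p + t *s br f p)) \<in> ?L" for t
        using killing_power_overshear[of "x + t *s f" ?k] by (simp add: field_def killing_left br_left)
      then show ?thesis by (rule polarize)
    qed
    \<comment> \<open>Choosing \<open>f = br x z\<close> in \<open>polar\<close> makes its mixed
      term equal to that of \<open>?k\<close> copies of \<open>bracket\<close>. The difference is,
      up to sign, \<open>?k - 1 = m\<close> times the wanted field, and \<open>m\<close> is nonzero
      in this case.\<close>
    have self: "field (\<lambda>p. ?\<kappa> x p ^ ?k) (br z x) \<in> ?L" for x z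
    proof -
      have "(\<lambda>p. (of_nat ?k *s ((?\<kappa> x p ^ m * ?\<kappa> (br x z) p) *s br x p
          + (?\<kappa> x p * ?\<kappa> x p ^ m) *s br (br x z) p))
          - ((of_nat ?k * ?\<kappa> x p ^ m * ?\<kappa> (br x z) p) *s br x p + ?\<kappa> x p ^ ?k *s br (br x z) p)) \<in> ?L"
        by (rule diff_overshear_algebra[OF scale_overshear_algebra[OF bracket[of x x z]] polar[of x "br x z"]])
      moreover have "of_nat ?k *s ((?\<kappa> x p ^ m * ?\<kappa> (br x z) p) *s br x p
          + (?\<kappa> x p * ?\<kappa> x p ^ m) *s br (br x z) p)
          - ((of_nat ?k * ?\<kappa> x p ^ m * ?\<kappa> (br x z) p) *s br x p + ?\<kappa> x p ^ ?k *s br (br x z) p)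
          = of_nat m *s (?\<kappa> x p ^ ?k *s br (br x z) p)" for p
        unfolding vec_eq_iff by (simp add: algebra_simps)
      ultimately have "(\<lambda>p. of_nat m *s (?\<kappa> x p ^ ?k *s br (br x z) p)) \<in> ?L" by (simp only:)
      from scale_overshear_algebra[OF this, of "- inverse (of_nat m)"]
      have "(\<lambda>p. (- inverse (of_nat m) * of_nat m) *s (?\<kappa> x p ^ ?k *s br (br x z) p)) \<in> ?L"
        by (simp only: vec.scale_scale[symmetric])
      moreover have "- inverse (of_nat m) * of_nat m = (- 1 :: complex)" using False by simp
      moreover have "(- 1) *s (?\<kappa> x p ^ ?k *s br (br x z) p) = ?\<kappa> x p ^ ?k *s br (br z x) p" for p
        by (simp add: br_anti[of z x] br_left)
      ultimately show ?thesis by (simp only: field_def)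
    qed
    \<comment> \<open>In the combination \<open>1 + 2 - 3\<close> the mixed terms cancel in pairs,
      and the two remaining terms agree because \<open>br f z = - br z f\<close>; hence the factor
      2.\<close>
    have all: "field (\<lambda>p. ?\<kappa> x p ^ ?k) (br z f) \<in> ?L" for x z f
    proof -
      have "(\<lambda>p. (?\<kappa> x p + t * ?\<kappa> f p) ^ ?k *s (br (br z x) p + t *s br (br z f) p)) \<in> ?L" for t
        using self[of "x + t *s f" z] by (simp add: field_def killing_left br_left br_right)
      then have 1: "(\<lambda>p. (of_nat ?k * ?\<kappa> x p ^ m * ?\<kappa> f p) *s br (br z x) p
          + ?\<kappa> x p ^ ?k *s br (br z f) p) \<in> ?L"
        by (rule polarize)
      have 2: "(\<lambda>p. of_nat ?k *s ((?\<kappa> x p ^ m * ?\<kappa> (br f z) p) *s br x p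
          + (?\<kappa> f p * ?\<kappa> x p ^ m) *s br (br x z) p)) \<in> ?L"
        using bracket by (rule scale_overshear_algebra)
      have 3: "(\<lambda>p. (of_nat ?k * ?\<kappa> x p ^ m * ?\<kappa> (br f z) p) *s br x p + ?\<kappa> x p ^ ?k *s br (br f z) p) \<in> ?L"
        by (rule polar)
      have "(\<lambda>p. (((of_nat ?k * ?\<kappa> x p ^ m * ?\<kappa> f p) *s br (br z x) p
            + ?\<kappa> x p ^ ?k *s br (br z f) p)
          + (of_nat ?k *s ((?\<kappa> x p ^ m * ?\<kappa> (br f z) p) *s br x p
            + (?\<kappa> f p * ?\<kappa> x p ^ m) *s br (br x z) p)
          - ((of_nat ?k * ?\<kappa> x p ^ m * ?\<kappa> (br f z) p) *s br x p
            + ?\<kappa> x p ^ ?k *s br (br f z) p)))) \<in> ?L"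
        by (rule add_overshear_algebra[OF 1 diff_overshear_algebra[OF 2 3]])
      moreover have "(((of_nat ?k * ?\<kappa> x p ^ m * ?\<kappa> f p) *s br (br z x) p
            + ?\<kappa> x p ^ ?k *s br (br z f) p)
          + (of_nat ?k *s ((?\<kappa> x p ^ m * ?\<kappa> (br f z) p) *s br x p
            + (?\<kappa> f p * ?\<kappa> x p ^ m) *s br (br x z) p)
          - ((of_nat ?k * ?\<kappa> x p ^ m * ?\<kappa> (br f z) p) *s br x p
            + ?\<kappa> x p ^ ?k *s br (br f z) p))) = 2 *s (?\<kappa> x p ^ ?k *s br (br z f) p)" for p
        unfolding vec_eq_iff br_anti[of x z] br_anti[of f z] br_left killing_minus
        by (simp add: algebra_simps)
      ultimately have "(\<lambda>p. 2 *s (?\<kappa> x p ^ ?k *s br (br z f) p)) \<in> ?L" by (simp only:)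
      from scale_overshear_algebra[OF this, of "inverse 2"]
      have "(\<lambda>p. (inverse 2 * 2) *s (?\<kappa> x p ^ ?k *s br (br z f) p)) \<in> ?L"
        by (simp only: vec.scale_scale[symmetric])
      then show ?thesis by (simp add: field_def)
    qed
    show ?thesis
      by (rule field_spanning_directions[OF perfect], elim CollectE exE conjE) (simp only: all)
  qed
qed

text \<open>Polarization trades one power of \<open>x\<close> for a factor \<open>y\<close>, while
  the remaining product rides along in the vector part \<open>?A\<close>. The exponent stays general
  because each new factor uses one up.\<close>

lemma product_field_in_overshear_algebra:
  "field (\<lambda>p. killing x p ^ k * (\<Prod>y\<leftarrow>ys. killing y p)) \<xi> \<in> overshear_algebra"
proof (induction ys arbitrary: x k)
  case Nil
  then show ?case using power_field_in_overshear_algebra by simp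
next
  case (Cons y ys)
  let ?A = "\<lambda>p. (\<Prod>y\<leftarrow>ys. killing y p) *s br \<xi> p"
  have "(\<lambda>p. (killing x p + t * killing y p) ^ Suc k *s (?A p + t *s 0)) \<in> overshear_algebra" for t
    using Cons.IH[of "x + t *s y" "Suc k"] by (simp add: field_def killing_left)
  then have "(\<lambda>p. (of_nat (Suc k) * killing x p ^ k * killing y p) *s ?A p
      + killing x p ^ Suc k *s 0) \<in> overshear_algebra"
    by (rule polarize)
  then have "(\<lambda>p. (of_nat (Suc k) * killing x p ^ k * killing y p) *s ?A p) \<in> overshear_algebra"
    by (simp only: vec.scale_zero_right add_0_right)
  from scale_overshear_algebra[OF this, of "inverse (of_nat (Suc k))"]
  show ?case by (simp add: field_def mult.assoc[symmetric] del: of_nat_Suc)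
qed

text \<open>The induction concerns multiplication by \<open>f\<close>, for all \<open>g\<close> at
  once, so that a product of polynomials becomes a composition. The list collects the linear
  factors.\<close>

lemma cpoly_field_in_overshear_algebra:
  assumes "f \<in> cpoly"
  shows "field f \<xi> \<in> overshear_algebra"
proof -
  let ?Q = "\<lambda>g. \<forall>ys \<xi>. field (\<lambda>p. g p * (\<Prod>y\<leftarrow>ys. killing y p)) \<xi> \<in> overshear_algebra"
  have closed: "\<forall>g. ?Q g \<longrightarrow> ?Q (\<lambda>p. f p * g p)"
    using assms
  proof induction
    case (const c)
    show ?case
    proof (intro allI impI)
      fix g ys \<xi> assume "?Q g"
      then have "field (\<lambda>p. g p * (\<Prod>y\<leftarrow>ys. killing y p)) \<xi> \<in> overshear_algebra" by blast
      from scale_overshear_algebra[OF this, of c]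
      show "field (\<lambda>p. c * g p * (\<Prod>y\<leftarrow>ys. killing y p)) \<xi> \<in> overshear_algebra"
        by (simp add: field_def mult.assoc)
    qed
  next
    case (coord i)
    \<comment> \<open>Nondegeneracy writes the coordinate as a Killing product, which then joins the
      list of factors.\<close>
    have "\<exists>d. \<forall>p. p $ i = killing d p" by (rule killing_represents) simp_all
    then obtain d where d: "\<And>p. p $ i = killing d p" by blast
    show ?case
    proof (intro allI impI)
      fix g ys \<xi> assume "?Q g"
      then have "field (\<lambda>p. g p * (\<Prod>y\<leftarrow>d # ys. killing y p)) \<xi> \<in> overshear_algebra" by blast
      then show "field (\<lambda>p. p $ i * g p * (\<Prod>y\<leftarrow>ys. killing y p)) \<xi> \<in> overshear_algebra"
        by (simp add: d mult.assoc mult.left_commute)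
    qed
  next
    case (add f1 f2)
    show ?case
    proof (intro allI impI)
      fix g ys \<xi> assume "?Q g"
      then have "field (\<lambda>p. f1 p * g p * (\<Prod>y\<leftarrow>ys. killing y p)) \<xi> \<in> overshear_algebra"
        "field (\<lambda>p. f2 p * g p * (\<Prod>y\<leftarrow>ys. killing y p)) \<xi> \<in> overshear_algebra"
        using add.IH by blast+
      from add_overshear_algebra[OF this]
      show "field (\<lambda>p. (f1 p + f2 p) * g p * (\<Prod>y\<leftarrow>ys. killing y p)) \<xi> \<in> overshear_algebra"
        by (simp add: field_def distrib_right vec.scale_left_distrib)
    qed
  next
    case (mult f1 f2)
    show ?case
    proof (intro allI impI)
      fix g ys \<xi> assume "?Q g"
      then have "?Q (\<lambda>p. f2 p * g p)" by (rule mult.IH(2)[THEN spec, THEN mp])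
      then have "?Q (\<lambda>p. f1 p * (f2 p * g p))" by (rule mult.IH(1)[THEN spec, THEN mp])
      then show "field (\<lambda>p. f1 p * f2 p * g p * (\<Prod>y\<leftarrow>ys. killing y p)) \<xi> \<in> overshear_algebra"
        by (simp add: mult.assoc)
    qed
  qed
  \<comment> \<open>The exponent 0 makes the power equal to \<open>1\<close> for every
    \<open>x\<close>, so \<open>x = 0\<close> is a mere placeholder.\<close>
  have "?Q (\<lambda>p. 1)"
    using product_field_in_overshear_algebra[of 0 0] by simp
  then have "?Q (\<lambda>p. f p * 1)" by (rule closed[THEN spec, THEN mp])
  then have "field (\<lambda>p. f p * 1 * (\<Prod>y\<leftarrow>[]. killing y p)) \<xi> \<in> overshear_algebra" by blast
  then show ?thesis by simp
qed

lemma poly_fields_subset: "poly_fields br \<subseteq> overshear_algebra"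
proof
  fix X assume "X \<in> poly_fields br"
  then show "X \<in> overshear_algebra"
  proof (induction rule: poly_fields_induct)
    case zero
    then show ?case by (rule lie_generated.zero)
  next
    case (add f \<xi> X)
    then show ?case by (intro add_overshear_algebra cpoly_field_in_overshear_algebra)
  qed
qed

end

theorem theorem4p6:
  fixes br :: "complex^'n \<Rightarrow> complex^'n \<Rightarrow> complex^'n"
  assumes "semisimple br"
  shows "lie_generated (overshears br) = poly_fields br"
proof -
  interpret semisimple_lie_alg br
    using assms by unfold_locales (auto simp: semisimple_def)
  show ?thesis using lie_generated_subset poly_fields_subset by (rule antisym)
qed

end
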